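(* (i) There exists a loop graph which is not precise. (ii) Let $\Gamma=(V,\mathcal E)$ be a loop graph and let $\Gamma'=(V',\mathcal E')\subset\mathbb R^d$ be any connected finite graph whose diameter is small enough. Take some vertices $v\in V$ and $v'\in V'$, and join a copy of $\Gamma'$ to each point of the vertex set $v+\mathbb Z^d$ by identifying the vertex $v'$ with each vertex of $v+\mathbb Z^d$. Then the obtained graph $\Gamma_*$ is a loop graph. Moreover, if $\Gamma$ is precise, then $\Gamma_*$ is also precise, and the precise quasimomentum $\vartheta_0$ of $\Gamma$ is also a precise quasimomentum of $\Gamma_*$.
   Context: A $\mathbb Z^d$-periodic graph $\Gamma=(V,\mathcal E)$ ($d\ge2$) is a connected graph embedded in $\mathbb R^d$, possibly with loops and multiple edges, with vertex set $V$ and set $\mathcal E$ of unoriented edges, such that: any bounded domain of $\mathbb R^d$ contains finitely many vertices; every vertex has finite degree (number of incident edges, a loop counted twice); and there is a basis $a_1,\ldots,a_d$ of $\mathbb R^d$ (the periods) with $\Gamma+a_s=\Gamma$ for $s=1,\ldots,d$. Coordinates are taken with some origin and axes along $a_1,\ldots,a_d$, so that $\Gamma+m=\Gamma$ for all $m\in\mathbb Z^d$. Each unoriented edge gives two oriented edges $(u,v)$ and $(v,u)$ (an unoriented loop gives two oriented loops); $\mathcal A$ is the set of oriented edges. The fundamental graph is $\Gamma_f=\Gamma/\mathbb Z^d$; it is finite, its vertices are identified with $V\cap[0,1)^d=\{v_1,\ldots,v_\nu\}$, and $\mathcal A_f=\mathcal A/\mathbb Z^d$ is its set of oriented edges. Every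 $v\in V$ is uniquely $v=[v]+\tilde v$ with $[v]\in\mathbb Z^d$, $\tilde v\in V\cap[0,1)^d$. The index of $\mathbf e=(u,v)\in\mathcal A$ is $\tau(\mathbf e)=[v]-[u]\in\mathbb Z^d$; it is $\mathbb Z^d$-translation invariant and defines the index of the corresponding edge of $\mathcal A_f$. Edges of $\mathcal A_f$ with nonzero index are called bridges; $\mathcal B_f$ is the set of bridges. The fundamental graph and the indices depend on the choice of periods and origin. A periodic graph $\Gamma$ is called a loop graph if all bridges of some fundamental graph $\Gamma_f$ (i.e. for some choice of periods and origin) are loops; this $\Gamma_f$ is called a loop fundamental graph. For a loop graph, the coordinates (hence $\mathbb Z^d$ and the indices) are those of a loop fundamental graph. A loop graph $\Gamma$ is called precise if $\cos\langle\tau(\mathbf e),\vartheta_0\rangle=-1$ for all bridges $\mathbf e\in\mathcal B_f$ of $\Gamma_f$ and some $\vartheta_0\in\mathbb T^d=\mathbb R^d/(2\pi\mathbb Z)^d$; such $\vartheta_0$ is called a precise quasimomentum of $\Gamma$. "Diameter small enough" means smaller than some positive constant depending on $\Gamma$ and $v$. *)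

theory Defs
  imports
    "HOL-Library.Uprod"
    "Graph_Theory.Digraph_Component"
    "HOL-Analysis.Analysis"
begin

section \<open>Multigraphs whose vertices are points\<close>

text \<open>
  Loops and multiple edges are allowed. An unoriented edge consists of its unordered pair of
  endpoints and a label; labels distinguish parallel edges, and a translation moves the endpoints
  of an edge while keeping its label. Every multigraph with finite degrees that is invariant under
  a group of translations can be so labelled: number the edges between two given vertices
  0, ..., k - 1. No curves are attached to the edges.
\<close>

record ('p, 'l) multigraph =
  vertices :: "'p set"
  edges :: "('p uprod \<times> 'l) set"

definition wf_multigraph :: "('p, 'l) multigraph \<Rightarrow> bool" where
  "wf_multigraph \<Gamma> \<longleftrightarrow> (\<forall>e\<in>edges \<Gamma>. set_uprod (fst e) \<subseteq> vertices \<Gamma>)"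

text \<open>
  The oriented edges. A non-loop gives \<open>(u, v, l, False)\<close> and \<open>(v, u, l, False)\<close>; the Boolean is
  needed because a loop gives two oriented loops \<open>(u, u, l, False)\<close> and \<open>(u, u, l, True)\<close>.
  Thus the out-degree of a vertex in the oriented graph is its degree, loops counted twice.
\<close>

type_synonym ('p, 'l) oriented_edge = "'p \<times> 'p \<times> 'l \<times> bool"

definition source :: "('p, 'l) oriented_edge \<Rightarrow> 'p" where
  "source e = fst e"

definition target :: "('p, 'l) oriented_edge \<Rightarrow> 'p" where
  "target e = fst (snd e)"

definition oriented_graph ::
    "('p, 'l) multigraph \<Rightarrow> ('p, ('p, 'l) oriented_edge) pre_digraph" where
  "oriented_graph \<Gamma> =
    \<lparr>verts = vertices \<Gamma>,
     arcs = {(u, v, l, b) | u v l b. (Upair u v, l) \<in> edges \<Gamma> \<and> (b \<longrightarrow> u = v)},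
     tail = source, head = target\<rparr>"

definition connected_multigraph :: "('p, 'l) multigraph \<Rightarrow> bool" where
  "connected_multigraph \<Gamma> \<longleftrightarrow> wf_multigraph \<Gamma> \<and> strongly_connected (oriented_graph \<Gamma>)"

definition finite_multigraph :: "('p, 'l) multigraph \<Rightarrow> bool" where
  "finite_multigraph \<Gamma> \<longleftrightarrow> finite (vertices \<Gamma>) \<and> finite (edges \<Gamma>)"

definition translate_graph ::
    "'p::ab_group_add \<Rightarrow> ('p, 'l) multigraph \<Rightarrow> ('p, 'l) multigraph" where
  "translate_graph w \<Gamma> =
    \<lparr>vertices = (\<lambda>x. x + w) ` vertices \<Gamma>,
     edges = map_prod (map_uprod (\<lambda>x. x + w)) id ` edges \<Gamma>\<rparr>"

definition translate_edge ::
    "'p::ab_group_add \<Rightarrow> ('p, 'l) oriented_edge \<Rightarrow> ('p, 'l) oriented_edge" where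
  "translate_edge w = (\<lambda>(u, v, l, b). (u + w, v + w, l, b))"


section \<open>Periodic graphs\<close>

definition periods :: "(real ^ 'n, 'l) multigraph \<Rightarrow> ('n::finite \<Rightarrow> real ^ 'n) \<Rightarrow> bool" where
  "periods \<Gamma> a \<longleftrightarrow>
    inj a \<and> independent (range a) \<and> span (range a) = UNIV \<and>
    (\<forall>s. translate_graph (a s) \<Gamma> = \<Gamma>)"

definition periodic_graph :: "(real ^ 'n::finite, 'l) multigraph \<Rightarrow> bool" where
  "periodic_graph \<Gamma> \<longleftrightarrow>
    connected_multigraph \<Gamma> \<and>
    (\<forall>S. bounded S \<longrightarrow> finite (vertices \<Gamma> \<inter> S)) \<and>
    (\<forall>v\<in>vertices \<Gamma>. finite (out_arcs (oriented_graph \<Gamma>) v)) \<and>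
    (\<exists>a. periods \<Gamma> a)"

text \<open>
  Coordinates are given by an origin \<open>p\<close> and the periods \<open>a\<close>: the point \<open>p + (\<Sum>i. t i *\<^sub>R a i)\<close> has
  coordinates \<open>t\<close>. In these coordinates \<open>lattice_vec a\<close> embeds the integer lattice and \<open>cell p a\<close>
  is the half-open unit cube.
\<close>

definition lattice_vec :: "('n::finite \<Rightarrow> real ^ 'n) \<Rightarrow> int ^ 'n \<Rightarrow> real ^ 'n" where
  "lattice_vec a m = (\<Sum>i\<in>UNIV. of_int (m $ i) *\<^sub>R a i)"

definition cell :: "real ^ 'n \<Rightarrow> ('n::finite \<Rightarrow> real ^ 'n) \<Rightarrow> (real ^ 'n) set" where
  "cell p a = {p + (\<Sum>i\<in>UNIV. t i *\<^sub>R a i) | t. \<forall>i. 0 \<le> t i \<and> t i < 1}"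

text \<open>
  The unique decomposition of a point \<open>x\<close> as \<open>lattice_vec a (int_part p a x) + frac_part p a x\<close>
  with \<open>frac_part p a x\<close> in the cell.
\<close>

definition int_part :: "real ^ 'n \<Rightarrow> ('n::finite \<Rightarrow> real ^ 'n) \<Rightarrow> real ^ 'n \<Rightarrow> int ^ 'n" where
  "int_part p a x = (THE m. x - lattice_vec a m \<in> cell p a)"

definition frac_part :: "real ^ 'n \<Rightarrow> ('n::finite \<Rightarrow> real ^ 'n) \<Rightarrow> real ^ 'n \<Rightarrow> real ^ 'n" where
  "frac_part p a x = x - lattice_vec a (int_part p a x)"

definition edge_index ::
    "real ^ 'n \<Rightarrow> ('n::finite \<Rightarrow> real ^ 'n) \<Rightarrow> (real ^ 'n, 'l) oriented_edge \<Rightarrow> int ^ 'n" where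
  "edge_index p a e = int_part p a (target e) - int_part p a (source e)"


section \<open>Fundamental graphs and loop graphs\<close>

definition orbit_rel ::
    "(real ^ 'n, 'l) multigraph \<Rightarrow> ('n::finite \<Rightarrow> real ^ 'n) \<Rightarrow>
      (real ^ 'n, 'l) oriented_edge rel" where
  "orbit_rel \<Gamma> a =
    {(e, f). e \<in> arcs (oriented_graph \<Gamma>) \<and> f \<in> arcs (oriented_graph \<Gamma>) \<and>
      (\<exists>m. f = translate_edge (lattice_vec a m) e)}"

text \<open>
  Vertices of the fundamental graph are identified with the vertices in the cell, and its oriented
  edges are the orbits of oriented edges. When \<open>a\<close> are periods, \<open>frac_part\<close> of an endpoint and
  \<open>edge_index\<close> are constant on each orbit, so that \<^const>\<open>the_elem\<close> is applied to singletons.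
\<close>

definition fundamental_graph ::
    "(real ^ 'n, 'l) multigraph \<Rightarrow> real ^ 'n \<Rightarrow> ('n::finite \<Rightarrow> real ^ 'n) \<Rightarrow>
      (real ^ 'n, (real ^ 'n, 'l) oriented_edge set) pre_digraph" where
  "fundamental_graph \<Gamma> p a =
    \<lparr>verts = vertices \<Gamma> \<inter> cell p a,
     arcs = arcs (oriented_graph \<Gamma>) // orbit_rel \<Gamma> a,
     tail = (\<lambda>E. the_elem ((\<lambda>e. frac_part p a (source e)) ` E)),
     head = (\<lambda>E. the_elem ((\<lambda>e. frac_part p a (target e)) ` E))\<rparr>"

definition orbit_index ::
    "real ^ 'n \<Rightarrow> ('n::finite \<Rightarrow> real ^ 'n) \<Rightarrow> (real ^ 'n, 'l) oriented_edge set \<Rightarrow> int ^ 'n" where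
  "orbit_index p a E = the_elem (edge_index p a ` E)"

definition bridges ::
    "(real ^ 'n, 'l) multigraph \<Rightarrow> real ^ 'n \<Rightarrow> ('n::finite \<Rightarrow> real ^ 'n) \<Rightarrow>
      (real ^ 'n, 'l) oriented_edge set set" where
  "bridges \<Gamma> p a = {E \<in> arcs (fundamental_graph \<Gamma> p a). orbit_index p a E \<noteq> 0}"

definition loop_fundamental ::
    "(real ^ 'n, 'l) multigraph \<Rightarrow> real ^ 'n \<Rightarrow> ('n::finite \<Rightarrow> real ^ 'n) \<Rightarrow> bool" where
  "loop_fundamental \<Gamma> p a \<longleftrightarrow>
    periods \<Gamma> a \<and>
    (\<forall>E\<in>bridges \<Gamma> p a. tail (fundamental_graph \<Gamma> p a) E = head (fundamental_graph \<Gamma> p a) E)"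

definition loop_graph :: "(real ^ 'n::finite, 'l) multigraph \<Rightarrow> bool" where
  "loop_graph \<Gamma> \<longleftrightarrow> periodic_graph \<Gamma> \<and> (\<exists>p a. loop_fundamental \<Gamma> p a)"

text \<open>
  A quasimomentum is a point of the torus of vectors modulo \<open>2\<pi>\<close>; it is given by any representative
  \<open>\<theta>\<close>, which does not affect the cosines below as the indices are integral.
\<close>

definition precise_quasimomentum ::
    "(real ^ 'n, 'l) multigraph \<Rightarrow> real ^ 'n \<Rightarrow> ('n::finite \<Rightarrow> real ^ 'n) \<Rightarrow> real ^ 'n \<Rightarrow> bool" where
  "precise_quasimomentum \<Gamma> p a \<theta> \<longleftrightarrow>
    loop_fundamental \<Gamma> p a \<and>
    (\<forall>E\<in>bridges \<Gamma> p a. cos ((\<chi> i. of_int (orbit_index p a E $ i)) \<bullet> \<theta>) = -1)"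

definition precise :: "(real ^ 'n::finite, 'l) multigraph \<Rightarrow> bool" where
  "precise \<Gamma> \<longleftrightarrow> loop_graph \<Gamma> \<and> (\<exists>p a \<theta>. precise_quasimomentum \<Gamma> p a \<theta>)"


section \<open>Decorating a periodic graph\<close>

text \<open>
  A translated copy of \<open>\<Gamma>'\<close> is put at each point of the lattice orbit of \<open>v\<close> such that \<open>v'\<close> lands on
  that point. The sum type keeps loops of \<open>\<Gamma>\<close> at \<open>v\<close> apart from loops of \<open>\<Gamma>'\<close> at \<open>v'\<close>. If \<open>\<Gamma>'\<close> has
  small diameter, the copies are disjoint and meet \<open>\<Gamma>\<close> only in the orbit of \<open>v\<close>; otherwise points
  that happen to coincide would be identified as well.
\<close>

definition attach_copies ::
    "(real ^ 'n, 'l) multigraph \<Rightarrow> ('n::finite \<Rightarrow> real ^ 'n) \<Rightarrow> real ^ 'n \<Rightarrow>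
      (real ^ 'n, 'k) multigraph \<Rightarrow> real ^ 'n \<Rightarrow> (real ^ 'n, 'l + 'k) multigraph" where
  "attach_copies \<Gamma> a v \<Gamma>' v' =
    (let copy = (\<lambda>m. translate_graph (v + lattice_vec a m - v') \<Gamma>')
     in \<lparr>vertices = vertices \<Gamma> \<union> (\<Union>m. vertices (copy m)),
         edges = map_prod id Inl ` edges \<Gamma> \<union> map_prod id Inr ` (\<Union>m. edges (copy m))\<rparr>)"

end

theory Submission
  imports Defs
begin

text \<open>
  If \<open>(p, a)\<close> gives a loop fundamental graph, its bridges are exactly the edges joining distinct
  points of one orbit of the lattice \<open>L\<close> spanned by \<open>a\<close>. An edge that can be translated
  indefinitely along its own vector must be such a bridge, as cells are bounded; by connectedness,
  all loop fundamental graphs of a graph therefore have the same lattice, so that precision does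
  not depend on the choice of periods.

  For (i), take the lattice \<open>L\<close> itself with edge vectors \<open>a i\<close> and \<open>a i0 + a j0\<close>: in any
  coordinates, the indices of \<open>a i0\<close>, \<open>a j0\<close> and \<open>a i0 + a j0\<close> cannot all have cosine \<open>-1\<close>.
  For (ii), shift the origin so that no vertex of \<open>\<Gamma>\<close> is near the boundary of a cell. Then every
  small copy of \<open>\<Gamma>'\<close> lies in one cell and contributes no bridges.
\<close>

section \<open>Coordinates with respect to a lattice basis\<close>

lemma lattice_vec_add: "lattice_vec a (m + k) = lattice_vec a m + lattice_vec a k"
  by (simp add: lattice_vec_def scaleR_add_left sum.distrib)

lemma lattice_vec_zero [simp]: "lattice_vec a 0 = 0"
  by (simp add: lattice_vec_def)

lemma lattice_vec_uminus: "lattice_vec a (- m) = - lattice_vec a m"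
  by (simp add: lattice_vec_def sum_negf)

lemma lattice_vec_diff: "lattice_vec a (m - k) = lattice_vec a m - lattice_vec a k"
  using lattice_vec_add[of a m "- k"] by (simp add: lattice_vec_uminus)

lemma lattice_vec_axis: "lattice_vec a (axis i 1) = a i"
proof -
  have "lattice_vec a (axis i 1) = (\<Sum>j\<in>UNIV. if j = i then a j else 0)"
    unfolding lattice_vec_def by (rule sum.cong) (auto simp: axis_def)
  then show ?thesis by simp
qed

text \<open>\<open>of_nat k\<close> is the vector with all entries \<open>k\<close> and vectors are
  multiplied componentwise, so \<open>of_nat k * m\<close> is the \<open>k\<close>-fold multiple of
  \<open>m\<close>.\<close>

lemma lattice_vec_of_nat_mult: "lattice_vec a (of_nat k * m) = of_nat k *\<^sub>R lattice_vec a m"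
  by (induction k) (simp_all add: lattice_vec_add scaleR_add_left distrib_right)

text \<open>The unit vectors generate the integer vectors as a group. Via
  \<open>lattice_vec_axis\<close>, the rule extends facts about the periods to all lattice
  vectors.\<close>

lemma int_vec_induct [case_names zero add uminus axis]:
  fixes m :: "int ^ 'n::finite"
  assumes "P 0" and add: "\<And>m k. P m \<Longrightarrow> P k \<Longrightarrow> P (m + k)"
    and uminus: "\<And>m. P m \<Longrightarrow> P (- m)" and axis: "\<And>i. P (axis i 1)"
  shows "P m"
proof -
  have nat: "P (of_nat k *s axis i 1)" for k i
    by (induction k) (simp_all add: assms vector_sadd_rdistrib)
  have int: "P (k *s axis i 1)" for k i
    using nat uminus[OF nat] by (cases k rule: int_cases2) (auto simp: vector_smult_lneg)
  have "finite S \<Longrightarrow> P (\<Sum>i\<in>S. m $ i *s axis i 1)" for S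
    by (induction S rule: finite_induct) (auto simp: assms int)
  then have "P (\<Sum>i\<in>UNIV. m $ i *s axis i 1)" by simp
  then show ?thesis by (simp add: basis_expansion)
qed

lemma diff_in_rangeE:
  fixes x y :: "'a::ab_group_add"
  assumes "y - x \<in> range f"
  obtains m where "y = x + f m"
  using assms by (metis add.commute diff_add_cancel imageE)

text \<open>The conditions of \<open>periods\<close> that do not mention a graph; coordinates depend
  on these alone.\<close>

locale lattice_basis =
  fixes a :: "'n::finite \<Rightarrow> real ^ 'n"
  assumes inj_basis: "inj a"
    and independent_basis: "independent (range a)"
    and span_basis: "span (range a) = UNIV"
begin

text \<open>Coordinates for the origin 0; those for an origin \<open>p\<close> are obtained as
  \<open>coord (x - p)\<close>.\<close>

definition coord :: "real ^ 'n \<Rightarrow> real ^ 'n" where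
  "coord x = (\<chi> i. representation (range a) x (a i))"

lemma linear_coord: "linear coord"
  by (rule linearI)
    (simp_all add: coord_def vec_eq_iff representation_add representation_scale
      independent_basis span_basis)

lemma coord_basis: "coord (a i) = axis i 1"
  unfolding coord_def axis_def representation_basis[OF independent_basis rangeI]
  by (simp add: inj_eq[OF inj_basis])

lemma coord_add: "coord (x + y) = coord x + coord y"
  and coord_diff: "coord (x - y) = coord x - coord y"
  and coord_scaleR: "coord (c *\<^sub>R x) = c *\<^sub>R coord x"
  using linear_coord by (simp_all add: linear_add linear_diff linear_scale)

lemma coord_sum: "coord (\<Sum>i\<in>UNIV. t i *\<^sub>R a i) = (\<chi> i. t i)"
proof -
  have "coord (\<Sum>i\<in>UNIV. t i *\<^sub>R a i) = (\<Sum>i\<in>UNIV. t i *\<^sub>R axis i 1)"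
    by (simp add: linear_sum[OF linear_coord] coord_scaleR coord_basis)
  also have "\<dots> = (\<chi> i. t i)"
    by (simp add: vec_eq_iff axis_def if_distrib cong: if_cong)
  finally show ?thesis .
qed

lemma sum_coord: "(\<Sum>i\<in>UNIV. coord x $ i *\<^sub>R a i) = x"
proof -
  have "(\<Sum>b\<in>range a. representation (range a) x b *\<^sub>R b) = x"
    by (rule real_vector.sum_representation_eq) (auto simp: independent_basis span_basis)
  then show ?thesis by (simp add: coord_def sum.reindex inj_basis)
qed

lemma coord_lattice_vec: "coord (lattice_vec a m) $ i = of_int (m $ i)"
  by (simp add: lattice_vec_def coord_sum)

lemma inj_lattice_vec: "inj (lattice_vec a)"
proof (rule injI)
  fix m k assume "lattice_vec a m = lattice_vec a k"
  then have "coord (lattice_vec a m) $ i = coord (lattice_vec a k) $ i" for i by simp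
  then show "m = k" by (simp add: coord_lattice_vec vec_eq_iff)
qed

lemma lattice_vec_eq_zero_iff [simp]: "lattice_vec a m = 0 \<longleftrightarrow> m = 0"
  using inj_eq[OF inj_lattice_vec, of m 0] by simp

section \<open>Cells, integer parts and fractional parts\<close>

lemma cell_iff: "x \<in> cell p a \<longleftrightarrow> (\<forall>i. 0 \<le> coord (x - p) $ i \<and> coord (x - p) $ i < 1)"
proof
  assume "x \<in> cell p a"
  then obtain t where "x = p + (\<Sum>i\<in>UNIV. t i *\<^sub>R a i)" "\<forall>i. 0 \<le> t i \<and> t i < 1"
    unfolding cell_def by blast
  then show "\<forall>i. 0 \<le> coord (x - p) $ i \<and> coord (x - p) $ i < 1" by (simp add: coord_sum)
next
  assume "\<forall>i. 0 \<le> coord (x - p) $ i \<and> coord (x - p) $ i < 1"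
  moreover have "x = p + (\<Sum>i\<in>UNIV. coord (x - p) $ i *\<^sub>R a i)" by (simp add: sum_coord)
  ultimately show "x \<in> cell p a"
    unfolding cell_def by (intro CollectI exI[of _ "\<lambda>i. coord (x - p) $ i"]) auto
qed

text \<open>Subtracting \<open>lattice_vec a m\<close> subtracts \<open>m\<close> from the
  coordinates, and exactly one integer translate of a real number lies in the half-open unit
  interval. Hence the description in \<open>int_part\<close> is well-defined.\<close>

lemma int_part_eq: "int_part p a x = (\<chi> i. \<lfloor>coord (x - p) $ i\<rfloor>)"
proof -
  have "x - lattice_vec a m \<in> cell p a \<longleftrightarrow> m = (\<chi> i. \<lfloor>coord (x - p) $ i\<rfloor>)" for m
  proof -
    have *: "coord (x - lattice_vec a m - p) $ i = coord (x - p) $ i - of_int (m $ i)" for i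
      by (simp add: coord_diff coord_lattice_vec)
    have "x - lattice_vec a m \<in> cell p a \<longleftrightarrow>
        (\<forall>i. of_int (m $ i) \<le> coord (x - p) $ i \<and> coord (x - p) $ i < of_int (m $ i) + 1)"
      unfolding cell_iff * by (simp add: algebra_simps)
    then show ?thesis by (auto simp: vec_eq_iff eq_commute[of _ "\<lfloor>_\<rfloor>"] floor_eq_iff)
  qed
  then show ?thesis by (simp add: int_part_def)
qed

lemma frac_part_in_cell: "frac_part p a x \<in> cell p a"
proof -
  have "coord (frac_part p a x - p) $ i = frac (coord (x - p) $ i)" for i
    by (simp add: frac_part_def int_part_eq coord_diff coord_lattice_vec frac_def)
  then show ?thesis by (simp add: cell_iff frac_ge_0 frac_lt_1)
qed

lemma int_part_translate: "int_part p a (x + lattice_vec a m) = int_part p a x + m"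
proof -
  have "coord (x + lattice_vec a m - p) $ i = coord (x - p) $ i + of_int (m $ i)" for i
    by (simp add: coord_diff coord_add coord_lattice_vec)
  then show ?thesis by (simp add: int_part_eq vec_eq_iff)
qed

lemma frac_part_translate: "frac_part p a (x + lattice_vec a m) = frac_part p a x"
  by (simp add: frac_part_def int_part_translate lattice_vec_add)

text \<open>Equal fractional parts mean the same vertex of the fundamental graph, so this is the
  test for loops; its right-hand side is free of the origin.\<close>

lemma frac_part_eq_iff: "frac_part p a x = frac_part p a y \<longleftrightarrow> y - x \<in> range (lattice_vec a)"
proof
  assume "frac_part p a x = frac_part p a y"
  moreover have "y - x = (frac_part p a y + lattice_vec a (int_part p a y)) -
      (frac_part p a x + lattice_vec a (int_part p a x))"
    by (simp add: frac_part_def)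
  ultimately have "y - x = lattice_vec a (int_part p a y - int_part p a x)"
    by (simp add: lattice_vec_diff)
  then show "y - x \<in> range (lattice_vec a)" by blast
next
  assume "y - x \<in> range (lattice_vec a)"
  then obtain m where "y = x + lattice_vec a m" by (rule diff_in_rangeE)
  then show "frac_part p a x = frac_part p a y" by (simp add: frac_part_translate)
qed

lemma bounded_cell: "bounded (cell p a)"
proof -
  have "norm x \<le> norm p + (\<Sum>i\<in>UNIV. norm (a i))" if "x \<in> cell p a" for x
  proof -
    from that obtain t where x: "x = p + (\<Sum>i\<in>UNIV. t i *\<^sub>R a i)" and t: "\<forall>i. 0 \<le> t i \<and> t i < 1"
      unfolding cell_def by blast
    have "norm (\<Sum>i\<in>UNIV. t i *\<^sub>R a i) \<le> (\<Sum>i\<in>UNIV. norm (a i))"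
      using t by (intro sum_norm_le) (simp add: mult_left_le_one_le order_less_imp_le)
    then show ?thesis
      unfolding x by (intro order_trans[OF norm_triangle_ineq] add_left_mono)
  qed
  then show ?thesis by (auto simp: bounded_iff)
qed

text \<open>
  Moving the origin slightly against the periods pushes all points of the invariant set \<open>V\<close> off the
  boundary of the half-open cells without changing their integer parts.
\<close>

lemma generic_origin:
  assumes fin: "finite (V \<inter> cell p a)"
    and inv: "\<And>x m. x \<in> V \<Longrightarrow> x + lattice_vec a m \<in> V"
  obtains q \<delta> where "0 < \<delta>"
    and "\<And>x y. x \<in> V \<Longrightarrow> dist x y < \<delta> \<Longrightarrow> int_part q a y = int_part p a x"
proof -
  \<comment> \<open>Distances from the coordinates of the points of \<open>V\<close> in the cell to
    its open upper faces; the extra 1 keeps the set nonempty when there are no such points.\<close>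
  define gaps where "gaps = insert 1 ((\<lambda>(x, i). 1 - coord (x - p) $ i) ` ((V \<inter> cell p a) \<times> UNIV))"
  have gaps: "finite gaps" "gaps \<noteq> {}" using fin by (auto simp: gaps_def)
  \<comment> \<open>Half of the least gap is spent on moving the origin, which raises every
    coordinate by \<open>\<epsilon>\<close>, and half on the distance between \<open>x\<close> and
    \<open>y\<close>.\<close>
  define \<epsilon> where "\<epsilon> = Min gaps / 2"
  have "0 < Min gaps"
    using gaps by (subst Min_gr_iff) (auto simp: gaps_def cell_iff)
  then have \<epsilon>: "0 < \<epsilon>" by (simp add: \<epsilon>_def)
  \<comment> \<open>\<open>K\<close> converts distances into differences of coordinates.\<close>
  obtain K where K: "0 < K" "\<And>x. norm (coord x) \<le> norm x * K"
    using linear_conv_bounded_linear linear_coord bounded_linear.pos_bounded by blast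
  define q where "q = p - \<epsilon> *\<^sub>R (\<Sum>i\<in>UNIV. a i)"
  show thesis
  proof (rule that)
    show "0 < \<epsilon> / K" using \<epsilon> K by simp
    fix x y assume x: "x \<in> V" and xy: "dist x y < \<epsilon> / K"
    have "\<lfloor>coord (y - q) $ i\<rfloor> = \<lfloor>coord (x - p) $ i\<rfloor>" for i
    proof -
      let ?c = "coord (x - p) $ i"
      let ?f = "frac_part p a x"
      have "?f = x + lattice_vec a (- int_part p a x)"
        by (simp add: frac_part_def lattice_vec_uminus)
      then have "?f \<in> V \<inter> cell p a" using inv[OF x] frac_part_in_cell by (metis IntI)
      then have "1 - coord (?f - p) $ i \<in> gaps" unfolding gaps_def by (intro insertI2) force
      then have "Min gaps \<le> 1 - coord (?f - p) $ i" using gaps by simp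
      moreover have "coord (?f - p) $ i = ?c - of_int \<lfloor>?c\<rfloor>"
        by (simp add: frac_part_def int_part_eq coord_diff coord_lattice_vec)
      ultimately have gap: "?c - of_int \<lfloor>?c\<rfloor> + 2 * \<epsilon> \<le> 1" by (simp add: \<epsilon>_def)
      have "\<bar>coord (y - x) $ i\<bar> \<le> norm (coord (y - x))" by (rule component_le_norm_cart)
      also have "\<dots> \<le> dist x y * K" using K(2)[of "y - x"] by (simp add: dist_norm norm_minus_commute)
      also have "\<dots> < \<epsilon>" using xy K(1) by (simp add: pos_less_divide_eq)
      finally have near: "\<bar>coord (y - x) $ i\<bar> < \<epsilon>" .
      have "coord (\<Sum>j\<in>UNIV. a j) $ i = 1" using coord_sum[of "\<lambda>_. 1"] by simp
      then have "coord (y - q) $ i = ?c + \<epsilon> + coord (y - x) $ i"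
        by (simp add: q_def coord_diff coord_scaleR)
      \<comment> \<open>The fractional part of \<open>?c\<close>, raised by
        \<open>\<epsilon>\<close> and then changed by less than \<open>\<epsilon>\<close>, stays
        strictly between 0 and 1 by \<open>gap\<close>.\<close>
      then show ?thesis using gap near by (simp add: floor_eq_iff) linarith
    qed
    then show "int_part q a y = int_part p a x" by (simp add: int_part_eq)
  qed
qed

end


section \<open>Edges, translations and connectedness\<close>

lemma arcs_oriented_graph:
  "(u, v, l, b) \<in> arcs (oriented_graph \<Gamma>) \<longleftrightarrow> (Upair u v, l) \<in> edges \<Gamma> \<and> (b \<longrightarrow> u = v)"
  by (simp add: oriented_graph_def)

lemma edges_eqI:
  assumes "\<And>u v l. (Upair u v, l) \<in> E \<longleftrightarrow> (Upair u v, l) \<in> F"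
  shows "E = F"
proof -
  have "(e, l) \<in> E \<longleftrightarrow> (e, l) \<in> F" for e l using assms by (cases e) simp
  then show ?thesis by auto
qed

lemma vertices_translate_graph: "x \<in> vertices (translate_graph w \<Gamma>) \<longleftrightarrow> x - w \<in> vertices \<Gamma>"
  by (force simp: translate_graph_def)

lemma edges_translate_graph:
  "(Upair u v, l) \<in> edges (translate_graph w \<Gamma>) \<longleftrightarrow> (Upair (u - w) (v - w), l) \<in> edges \<Gamma>"
proof
  assume "(Upair u v, l) \<in> edges (translate_graph w \<Gamma>)"
  then obtain e where e: "(e, l) \<in> edges \<Gamma>" "Upair u v = map_uprod (\<lambda>x. x + w) e"
    by (auto simp: translate_graph_def)
  then have "Upair (u - w) (v - w) = map_uprod (\<lambda>x. x - w) (map_uprod (\<lambda>x. x + w) e)"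
    by (metis map_uprod_simps)
  also have "\<dots> = e" by (simp add: uprod.map_comp o_def uprod.map_ident)
  finally show "(Upair (u - w) (v - w), l) \<in> edges \<Gamma>" using e by simp
next
  assume "(Upair (u - w) (v - w), l) \<in> edges \<Gamma>"
  then have "map_prod (map_uprod (\<lambda>x. x + w)) id (Upair (u - w) (v - w), l) \<in> edges (translate_graph w \<Gamma>)"
    by (simp add: translate_graph_def del: map_prod_simp)
  then show "(Upair u v, l) \<in> edges (translate_graph w \<Gamma>)" by simp
qed

lemma translate_graph_eq_iff:
  "translate_graph w \<Gamma> = \<Gamma> \<longleftrightarrow>
    (\<forall>x. x - w \<in> vertices \<Gamma> \<longleftrightarrow> x \<in> vertices \<Gamma>) \<and>
    (\<forall>u v l. (Upair (u - w) (v - w), l) \<in> edges \<Gamma> \<longleftrightarrow> (Upair u v, l) \<in> edges \<Gamma>)"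
  (is "_ \<longleftrightarrow> ?V \<and> ?E")
proof
  assume "translate_graph w \<Gamma> = \<Gamma>"
  then show "?V \<and> ?E" using vertices_translate_graph[of _ w \<Gamma>] edges_translate_graph[of _ _ _ w \<Gamma>] by simp
next
  assume "?V \<and> ?E"
  then have "vertices (translate_graph w \<Gamma>) = vertices \<Gamma>" "edges (translate_graph w \<Gamma>) = edges \<Gamma>"
    using vertices_translate_graph[of _ w \<Gamma>] edges_translate_graph[of _ _ _ w \<Gamma>]
    by (blast, intro edges_eqI) auto
  moreover have "multigraph.more (translate_graph w \<Gamma>) = multigraph.more \<Gamma>" by simp
  ultimately show "translate_graph w \<Gamma> = \<Gamma>" by (simp add: multigraph.equality)
qed

lemma translate_graph_eq_add:
  assumes "translate_graph w \<Gamma> = \<Gamma>" "translate_graph w' \<Gamma> = \<Gamma>"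
  shows "translate_graph (w + w') \<Gamma> = \<Gamma>"
  using assms unfolding translate_graph_eq_iff diff_diff_eq[symmetric] by simp

lemma translate_graph_eq_uminus:
  assumes "translate_graph w \<Gamma> = \<Gamma>"
  shows "translate_graph (- w) \<Gamma> = \<Gamma>"
  using assms unfolding translate_graph_eq_iff by (metis diff_minus_eq_add add_diff_cancel_right')

lemma translate_graph_zero: "translate_graph 0 \<Gamma> = \<Gamma>"
  by (simp add: translate_graph_eq_iff)

text \<open>The translations preserving \<open>\<Gamma>\<close> form a group containing the periods,
  hence the lattice they generate.\<close>

lemma translate_graph_lattice_vec:
  assumes "periods \<Gamma> a"
  shows "translate_graph (lattice_vec a m) \<Gamma> = \<Gamma>"
  using assms
  by (induction m rule: int_vec_induct)
    (simp_all add: translate_graph_zero translate_graph_eq_add translate_graph_eq_uminus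
      lattice_vec_add lattice_vec_uminus lattice_vec_axis periods_def)

lemma
  assumes "periods \<Gamma> a"
  shows vertices_add_lattice_vec: "x + lattice_vec a m \<in> vertices \<Gamma> \<longleftrightarrow> x \<in> vertices \<Gamma>"
    and edges_add_lattice_vec:
      "(Upair (u + lattice_vec a m) (w + lattice_vec a m), l) \<in> edges \<Gamma> \<longleftrightarrow> (Upair u w, l) \<in> edges \<Gamma>"
  using translate_graph_lattice_vec[OF assms, of m] unfolding translate_graph_eq_iff
  by (metis add_diff_cancel_right')+

lemma periods_lattice_basis: "periods \<Gamma> a \<Longrightarrow> lattice_basis a"
  by (simp add: periods_def lattice_basis_def)

section \<open>Connectedness and degrees\<close>

definition adjacency :: "('p, 'l) multigraph \<Rightarrow> 'p rel" where
  "adjacency \<Gamma> = {(u, v). \<exists>l. (Upair u v, l) \<in> edges \<Gamma>}"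

lemma edge_in_adjacency: "(Upair u v, l) \<in> edges \<Gamma> \<Longrightarrow> (u, v) \<in> adjacency \<Gamma>"
  by (auto simp: adjacency_def)

lemma arcs_ends_oriented_graph: "arcs_ends (oriented_graph \<Gamma>) = adjacency \<Gamma>"
  by (force simp: arcs_ends_def arc_to_ends_def oriented_graph_def adjacency_def source_def
      target_def image_iff)

lemma sym_adjacency_rtrancl: "sym ((adjacency \<Gamma>)\<^sup>*)"
proof (rule sym_rtrancl, rule symI)
  fix u v assume "(u, v) \<in> adjacency \<Gamma>"
  moreover have "Upair u v = Upair v u" by simp
  ultimately show "(v, u) \<in> adjacency \<Gamma>" unfolding adjacency_def by (metis (mono_tags) case_prodI mem_Collect_eq case_prodD)
qed

lemma wf_multigraphD:
  assumes "wf_multigraph \<Gamma>" "(Upair u v, l) \<in> edges \<Gamma>"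
  shows "u \<in> vertices \<Gamma>" "v \<in> vertices \<Gamma>"
  using assms by (auto simp: wf_multigraph_def)

lemma wf_multigraphI:
  assumes "\<And>u v l. (Upair u v, l) \<in> edges \<Gamma> \<Longrightarrow> u \<in> vertices \<Gamma> \<and> v \<in> vertices \<Gamma>"
  shows "wf_multigraph \<Gamma>"
  unfolding wf_multigraph_def
proof
  fix e assume "e \<in> edges \<Gamma>"
  moreover obtain u v l where "e = (Upair u v, l)" by (metis surj_pair uprod_exhaust)
  ultimately show "set_uprod (fst e) \<subseteq> vertices \<Gamma>" using assms by auto
qed

text \<open>\<open>reachable\<close> confines walks to the vertex set. Well-formedness makes this
  automatic, as edges end in vertices, so plain closure of the adjacency relation suffices.\<close>

lemma connected_multigraph_iff:
  "connected_multigraph \<Gamma> \<longleftrightarrow> wf_multigraph \<Gamma> \<and> vertices \<Gamma> \<noteq> {} \<and>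
    (\<forall>u\<in>vertices \<Gamma>. \<forall>v\<in>vertices \<Gamma>. (u, v) \<in> (adjacency \<Gamma>)\<^sup>*)"
proof (cases "wf_multigraph \<Gamma>")
  case True
  have "v \<in> vertices \<Gamma>" if "(u, v) \<in> adjacency \<Gamma>" for u v
    using that wf_multigraphD[OF True] by (auto simp: adjacency_def)
  then have "(u, v) \<in> rtrancl_on (vertices \<Gamma>) (adjacency \<Gamma>) \<longleftrightarrow> (u, v) \<in> (adjacency \<Gamma>)\<^sup>*"
    if "u \<in> vertices \<Gamma>" "v \<in> vertices \<Gamma>" for u v
    using that by (meson rtrancl_consistent_rtrancl_on rtrancl_on_rtranclI)
  moreover have "verts (oriented_graph \<Gamma>) = vertices \<Gamma>" by (simp add: oriented_graph_def)
  ultimately show ?thesis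
    using True
    by (simp add: connected_multigraph_def strongly_connected_def reachable_def arcs_ends_oriented_graph)
qed (simp add: connected_multigraph_def)

text \<open>The Boolean tag at most doubles the number of arcs, so degrees may be checked on
  labelled neighbours.\<close>

lemma finite_out_arcs_iff:
  "finite (out_arcs (oriented_graph \<Gamma>) u) \<longleftrightarrow> finite {(w, l). (Upair u w, l) \<in> edges \<Gamma>}"
  (is "finite ?A \<longleftrightarrow> finite ?N")
proof
  assume "finite ?A"
  then have "finite ((\<lambda>(u, w, l, b). (w, l)) ` ?A)" by (rule finite_imageI)
  moreover have "(w, l) \<in> (\<lambda>(u, w, l, b). (w, l)) ` ?A" if "(Upair u w, l) \<in> edges \<Gamma>" for w l
    using that
    by (intro image_eqI[of _ _ "(u, w, l, False)"]) (auto simp: out_arcs_def oriented_graph_def source_def)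
  ultimately show "finite ?N" by (auto intro: finite_subset)
next
  let ?F = "(\<lambda>((w, l), b :: bool). (u, w, l, b)) ` (?N \<times> UNIV)"
  assume "finite ?N"
  then have "finite ?F" by (intro finite_imageI finite_cartesian_product) simp_all
  moreover have "?A \<subseteq> ?F"
  proof
    fix e assume "e \<in> ?A"
    moreover obtain u' w l b where "e = (u', w, l, b)" by (cases e)
    ultimately show "e \<in> ?F"
      by (intro image_eqI[of _ _ "((w, l), b)"]) (auto simp: out_arcs_def oriented_graph_def source_def)
  qed
  ultimately show "finite ?A" by (rule rev_finite_subset)
qed


section \<open>Loop fundamental graphs and precise quasimomenta in terms of edges\<close>

text \<open>Any representative of an orbit may be used: a lattice translation keeps fractional parts
  and shifts both integer parts by the same vector.\<close>

lemma
  fixes p :: "real ^ 'n::finite" and a \<Gamma> u v l b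
  defines "E \<equiv> orbit_rel \<Gamma> a `` {(u, v, l, b)}"
  assumes per: "periods \<Gamma> a" and e: "(u, v, l, b) \<in> arcs (oriented_graph \<Gamma>)"
  shows tail_orbit: "tail (fundamental_graph \<Gamma> p a) E = frac_part p a u"
    and head_orbit: "head (fundamental_graph \<Gamma> p a) E = frac_part p a v"
    and orbit_index_orbit: "orbit_index p a E = int_part p a v - int_part p a u"
proof -
  interpret lattice_basis a using per by (rule periods_lattice_basis)
  have e_in: "(u, v, l, b) \<in> E"
    using e by (auto simp: E_def orbit_rel_def translate_edge_def intro: exI[of _ 0])
  have mem: "\<exists>m. f = (u + lattice_vec a m, v + lattice_vec a m, l, b)" if "f \<in> E" for f
    using that by (auto simp: E_def orbit_rel_def translate_edge_def)
  \<comment> \<open>A function invariant under lattice translations takes a single value on the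
    orbit, and \<open>the_elem\<close> returns it.\<close>
  have const: "the_elem (h ` E) = h (u, v, l, b)"
    if h: "\<And>m. h (u + lattice_vec a m, v + lattice_vec a m, l, b) = h (u, v, l, b)"
    for h :: "_ \<Rightarrow> 'c"
  proof -
    have "h f = h (u, v, l, b)" if "f \<in> E" for f using mem[OF that] h by metis
    then have "h ` E = {h (u, v, l, b)}" using e_in by (metis image_is_empty equals0D image_constant_conv image_cong)
    then show ?thesis by simp
  qed
  show "tail (fundamental_graph \<Gamma> p a) E = frac_part p a u"
    by (simp add: fundamental_graph_def const source_def frac_part_translate)
  show "head (fundamental_graph \<Gamma> p a) E = frac_part p a v"
    by (simp add: fundamental_graph_def const target_def frac_part_translate)
  show "orbit_index p a E = int_part p a v - int_part p a u"
    by (simp add: orbit_index_def const edge_index_def source_def target_def int_part_translate)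
qed

text \<open>Replaces quantification over orbits by quantification over edges. \<open>P\<close> will
  be the loop condition or the cosine condition, both of which are determined by the endpoints of a
  representative.\<close>

lemma ball_bridges_iff:
  assumes per: "periods \<Gamma> a"
    and P: "\<And>u v l b. (u, v, l, b) \<in> arcs (oriented_graph \<Gamma>) \<Longrightarrow>
      P (orbit_rel \<Gamma> a `` {(u, v, l, b)}) \<longleftrightarrow> Q u v"
  shows "(\<forall>E\<in>bridges \<Gamma> p a. P E) \<longleftrightarrow>
    (\<forall>u v l. (Upair u v, l) \<in> edges \<Gamma> \<longrightarrow> int_part p a u \<noteq> int_part p a v \<longrightarrow> Q u v)"
proof (intro iffI allI impI ballI)
  fix u v l assume *: "\<forall>E\<in>bridges \<Gamma> p a. P E" "(Upair u v, l) \<in> edges \<Gamma>"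
    "int_part p a u \<noteq> int_part p a v"
  then have arc: "(u, v, l, False) \<in> arcs (oriented_graph \<Gamma>)" by (simp add: arcs_oriented_graph)
  then have "orbit_rel \<Gamma> a `` {(u, v, l, False)} \<in> bridges \<Gamma> p a"
    using * by (simp add: bridges_def fundamental_graph_def quotientI orbit_index_orbit[OF per arc])
  then show "Q u v" using * P[OF arc] by blast
next
  fix E assume *: "\<forall>u v l. (Upair u v, l) \<in> edges \<Gamma> \<longrightarrow> int_part p a u \<noteq> int_part p a v \<longrightarrow> Q u v"
    and E: "E \<in> bridges \<Gamma> p a"
  then obtain u v l b where arc: "(u, v, l, b) \<in> arcs (oriented_graph \<Gamma>)"
    and E_eq: "E = orbit_rel \<Gamma> a `` {(u, v, l, b)}"
    by (auto simp: bridges_def fundamental_graph_def elim!: quotientE)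
  have "int_part p a u \<noteq> int_part p a v"
    using E by (auto simp: bridges_def E_eq orbit_index_orbit[OF per arc])
  then show "P E" using * arc P[OF arc] unfolding E_eq by (auto simp: arcs_oriented_graph)
qed

text \<open>By \<open>frac_part_eq_iff\<close>, tail and head of an orbit agree exactly when the
  edge vector lies in the lattice.\<close>

lemma loop_fundamental_iff:
  "loop_fundamental \<Gamma> p a \<longleftrightarrow> periods \<Gamma> a \<and>
    (\<forall>u v l. (Upair u v, l) \<in> edges \<Gamma> \<longrightarrow> int_part p a u \<noteq> int_part p a v \<longrightarrow>
      v - u \<in> range (lattice_vec a))"
proof (cases "periods \<Gamma> a")
  case True
  then interpret lattice_basis a by (rule periods_lattice_basis)
  show ?thesis
    unfolding loop_fundamental_def
    using True
    by (subst ball_bridges_iff[where Q = "\<lambda>u v. v - u \<in> range (lattice_vec a)"])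
      (simp_all add: tail_orbit head_orbit frac_part_eq_iff)
qed (simp add: loop_fundamental_def)

text \<open>
  In a loop fundamental graph, the bridges are the edges joining distinct points of one lattice
  orbit; hence the condition below does not depend on the origin.
\<close>

lemma precise_quasimomentum_iff:
  "precise_quasimomentum \<Gamma> p a \<theta> \<longleftrightarrow> loop_fundamental \<Gamma> p a \<and>
    (\<forall>u l m. (Upair u (u + lattice_vec a m), l) \<in> edges \<Gamma> \<longrightarrow> m \<noteq> 0 \<longrightarrow>
      cos ((\<chi> i. of_int (m $ i)) \<bullet> \<theta>) = -1)"
proof (cases "loop_fundamental \<Gamma> p a")
  case True
  then have per: "periods \<Gamma> a" by (simp add: loop_fundamental_def)
  then interpret lattice_basis a by (rule periods_lattice_basis)
  let ?c = "\<lambda>m :: int ^ 'a. cos ((\<chi> i. of_int (m $ i)) \<bullet> \<theta>) = -1"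
  have "precise_quasimomentum \<Gamma> p a \<theta> \<longleftrightarrow>
    (\<forall>u v l. (Upair u v, l) \<in> edges \<Gamma> \<longrightarrow> int_part p a u \<noteq> int_part p a v \<longrightarrow>
      ?c (int_part p a v - int_part p a u))"
    unfolding precise_quasimomentum_def
    using True per
    by (subst ball_bridges_iff[where Q = "\<lambda>u v. ?c (int_part p a v - int_part p a u)"])
      (simp_all add: orbit_index_orbit)
  also have "\<dots> \<longleftrightarrow> (\<forall>u l m. (Upair u (u + lattice_vec a m), l) \<in> edges \<Gamma> \<longrightarrow> m \<noteq> 0 \<longrightarrow> ?c m)"
    (is "?L \<longleftrightarrow> ?R")
  proof
    assume L: ?L
    show ?R
    proof (intro allI impI)
      fix u l m assume "(Upair u (u + lattice_vec a m), l) \<in> edges \<Gamma>" "m \<noteq> 0"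
      then show "?c m" using L[rule_format, of u "u + lattice_vec a m" l] by (simp add: int_part_translate)
    qed
  next
    assume R: ?R
    show ?L
    proof (intro allI impI)
      fix u v l assume e: "(Upair u v, l) \<in> edges \<Gamma>" "int_part p a u \<noteq> int_part p a v"
      \<comment> \<open>A bridge of a loop fundamental graph has a lattice vector as edge vector,
        and its index is the coordinate vector \<open>m\<close> of that vector.\<close>
      then have "v - u \<in> range (lattice_vec a)" using True by (auto simp: loop_fundamental_iff)
      then obtain m where "v = u + lattice_vec a m" by (rule diff_in_rangeE)
      then show "?c (int_part p a v - int_part p a u)"
        using R e by (auto simp: int_part_translate)
    qed
  qed
  finally show ?thesis using True by simp
qed (simp add: precise_quasimomentum_def)

section \<open>Independence of the choice of the loop fundamental graph\<close>

text \<open>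
  If \<open>w\<close> is not in the lattice, all these edges have index zero, and so the points
  \<open>u + k *\<^sub>R w\<close> stay in one cell, which is bounded.
\<close>

lemma edge_vector_in_lattice:
  assumes lf: "loop_fundamental \<Gamma> p a" and "w \<noteq> 0"
    and edge: "\<And>k :: nat. (Upair (u + of_nat k *\<^sub>R w) (u + of_nat k *\<^sub>R w + w), l) \<in> edges \<Gamma>"
  shows "w \<in> range (lattice_vec a)"
proof (rule ccontr)
  assume w: "w \<notin> range (lattice_vec a)"
  interpret lattice_basis a using lf by (auto simp: loop_fundamental_def intro: periods_lattice_basis)
  \<comment> \<open>A change of integer part would make this edge a bridge, and bridges have edge
    vectors in the lattice.\<close>
  have "int_part p a (u + of_nat k *\<^sub>R w) = int_part p a (u + of_nat k *\<^sub>R w + w)" for k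
    using edge[of k] lf w unfolding loop_fundamental_iff by (metis add_diff_cancel_left')
  then have const: "int_part p a (u + of_nat k *\<^sub>R w) = int_part p a u" for k :: nat
    by (induction k) (simp_all add: scaleR_add_left ac_simps)
  obtain B where B: "\<And>x. x \<in> cell p a \<Longrightarrow> norm x \<le> B"
    using bounded_cell[of p] by (auto simp: bounded_iff)
  have bound: "of_nat k * norm w \<le> B + B" for k
  proof -
    have "of_nat k *\<^sub>R w = frac_part p a (u + of_nat k *\<^sub>R w) - frac_part p a u"
      by (simp add: frac_part_def const)
    then have "norm (of_nat k *\<^sub>R w) \<le> norm (frac_part p a (u + of_nat k *\<^sub>R w)) + norm (frac_part p a u)"
      by (metis norm_triangle_ineq4)
    also have "\<dots> \<le> B + B" by (intro add_mono B frac_part_in_cell)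
    finally show ?thesis by simp
  qed
  obtain k :: nat where "B + B < of_nat k * norm w"
    using reals_Archimedean3[of "norm w"] \<open>w \<noteq> 0\<close> by auto
  then show False using bound[of k] by simp
qed

text \<open>Along a walk from \<open>u\<close> to \<open>u + lattice_vec a m\<close> the indices of
  the edges add up to \<open>m\<close>. Only bridges contribute, each its own edge vector, which
  lies in the other lattice by \<open>edge_vector_in_lattice\<close>.\<close>

lemma loop_lattice_mono:
  assumes conn: "connected_multigraph \<Gamma>"
    and lf: "loop_fundamental \<Gamma> p a" and lf': "loop_fundamental \<Gamma> p' a'"
  shows "range (lattice_vec a) \<subseteq> range (lattice_vec a')"
proof -
  let ?L = "range (lattice_vec a')"
  have per: "periods \<Gamma> a" using lf by (simp add: loop_fundamental_def)
  then interpret lattice_basis a by (rule periods_lattice_basis)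
  have edge: "lattice_vec a (int_part p a v - int_part p a u) \<in> ?L" if "(u, v) \<in> adjacency \<Gamma>" for u v
  proof (cases "int_part p a u = int_part p a v")
    case True
    then show ?thesis using rangeI[of "lattice_vec a'" 0] by simp
  next
    case False
    from that obtain l where e: "(Upair u v, l) \<in> edges \<Gamma>" by (auto simp: adjacency_def)
    then have "v - u \<in> range (lattice_vec a)" using lf False unfolding loop_fundamental_iff by blast
    then obtain m where m: "v = u + lattice_vec a m" by (rule diff_in_rangeE)
    with False have "lattice_vec a m \<noteq> 0" by auto
    \<comment> \<open>The bridge vector is a lattice vector of \<open>a\<close>, so
      \<open>\<Gamma>\<close> is invariant under it and the edge can be moved along it any number of
      times.\<close>
    moreover have "(Upair (u + of_nat k *\<^sub>R lattice_vec a m)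
        (u + of_nat k *\<^sub>R lattice_vec a m + lattice_vec a m), l) \<in> edges \<Gamma>" for k :: nat
      using e edges_add_lattice_vec[OF per, of u "of_nat k * m" v l]
      by (simp add: m lattice_vec_of_nat_mult add.assoc add.commute[of "lattice_vec a m"])
    ultimately have "lattice_vec a m \<in> ?L" by (rule edge_vector_in_lattice[OF lf'])
    then show ?thesis by (simp add: m int_part_translate)
  qed
  have walk: "lattice_vec a (int_part p a v - int_part p a u) \<in> ?L" if "(u, v) \<in> (adjacency \<Gamma>)\<^sup>*" for u v
    using that
  proof (induction rule: rtrancl_induct)
    case base
    then show ?case using rangeI[of "lattice_vec a'" 0] by simp
  next
    case (step v w)
    then obtain m m' where "lattice_vec a (int_part p a v - int_part p a u) = lattice_vec a' m"
      "lattice_vec a (int_part p a w - int_part p a v) = lattice_vec a' m'"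
      using edge[OF step.hyps(2)] by (metis imageE)
    moreover have "int_part p a w - int_part p a u =
        (int_part p a v - int_part p a u) + (int_part p a w - int_part p a v)" by simp
    ultimately have "lattice_vec a (int_part p a w - int_part p a u) = lattice_vec a' (m + m')"
      by (metis lattice_vec_add)
    then show ?case by simp
  qed
  show ?thesis
  proof
    fix x assume "x \<in> range (lattice_vec a)"
    then obtain m where m: "x = lattice_vec a m" by blast
    obtain u where "u \<in> vertices \<Gamma>" using conn by (auto simp: connected_multigraph_iff)
    then have "(u, u + lattice_vec a m) \<in> (adjacency \<Gamma>)\<^sup>*"
      using conn vertices_add_lattice_vec[OF per] by (auto simp: connected_multigraph_iff)
    from walk[OF this] show "x \<in> ?L" by (simp add: m int_part_translate)
  qed
qed

text \<open>Quasimomenta transform dually to indices: if the rows of \<open>M\<close> express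
  \<open>a\<close> in terms of \<open>a'\<close>, then \<open>\<theta>\<close> is \<open>M\<close>
  applied to \<open>\<theta>'\<close>, and the pairing of an index with the quasimomentum is the
  same in both coordinate systems.\<close>

lemma precise_quasimomentum_change_periods:
  assumes conn: "connected_multigraph \<Gamma>"
    and lf: "loop_fundamental \<Gamma> p a" and pq': "precise_quasimomentum \<Gamma> p' a' \<theta>'"
  obtains \<theta> where "precise_quasimomentum \<Gamma> p a \<theta>"
proof -
  have lf': "loop_fundamental \<Gamma> p' a'" using pq' by (simp add: precise_quasimomentum_def)
  interpret lattice_basis a using lf by (auto simp: loop_fundamental_def intro: periods_lattice_basis)
  have "a i \<in> range (lattice_vec a')" for i
    using loop_lattice_mono[OF conn lf lf'] lattice_vec_axis[of a i] by (metis rangeI subsetD)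
  then have "\<forall>i. \<exists>m. a i = lattice_vec a' m" by blast
  then obtain M where M: "\<And>i. a i = lattice_vec a' (M i)" by metis
  define \<theta> :: "real ^ 'a" where "\<theta> = (\<chi> i. (\<chi> j. of_int (M i $ j)) \<bullet> \<theta>')"
  have "cos ((\<chi> i. of_int (m $ i)) \<bullet> \<theta>) = -1"
    if e: "(Upair u (u + lattice_vec a m), l) \<in> edges \<Gamma>" and "m \<noteq> 0" for u l m
  proof -
    \<comment> \<open>The coordinates of the same edge vector with respect to
      \<open>a'\<close>.\<close>
    define m' where "m' = (\<Sum>i\<in>UNIV. m $ i *s M i)"
    have "lattice_vec a m = (\<Sum>i\<in>UNIV. \<Sum>j\<in>UNIV. of_int (m $ i * M i $ j) *\<^sub>R a' j)"
      by (simp add: lattice_vec_def[of a] M) (simp add: lattice_vec_def scaleR_sum_right)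
    also have "\<dots> = lattice_vec a' m'"
      by (subst sum.swap) (simp add: lattice_vec_def m'_def scaleR_sum_left)
    finally have eq: "lattice_vec a m = lattice_vec a' m'" .
    have "(\<chi> i. of_int (m $ i)) \<bullet> \<theta> = (\<Sum>i\<in>UNIV. \<Sum>j\<in>UNIV. of_int (m $ i * M i $ j) * \<theta>' $ j)"
      by (simp add: \<theta>_def inner_vec_def sum_distrib_left mult.assoc)
    also have "\<dots> = (\<chi> i. of_int (m' $ i)) \<bullet> \<theta>'"
      by (subst sum.swap) (simp add: inner_vec_def m'_def sum_distrib_right)
    finally have "(\<chi> i. of_int (m $ i)) \<bullet> \<theta> = (\<chi> i. of_int (m' $ i)) \<bullet> \<theta>'" .
    moreover have "m' \<noteq> 0" using eq \<open>m \<noteq> 0\<close> by auto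
    moreover have "(Upair u (u + lattice_vec a' m'), l) \<in> edges \<Gamma>" using e eq by simp
    ultimately show ?thesis using pq' by (simp add: precise_quasimomentum_iff)
  qed
  then have "precise_quasimomentum \<Gamma> p a \<theta>" using lf by (simp add: precise_quasimomentum_iff)
  then show thesis by (rule that)
qed


section \<open>A loop graph that is not precise\<close>

text \<open>For \<open>D\<close> in the lattice this is the Cayley graph with connection set
  \<open>D\<close>. A single label is used, so there are no parallel edges.\<close>

definition lattice_graph :: "('n::finite \<Rightarrow> real ^ 'n) \<Rightarrow> (real ^ 'n) set \<Rightarrow> (real ^ 'n, 'l) multigraph" where
  "lattice_graph a D =
    \<lparr>vertices = range (lattice_vec a),
     edges = {(Upair x (x + d), undefined) | x d. x \<in> range (lattice_vec a) \<and> d \<in> D}\<rparr>"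

lemma edges_lattice_graph:
  "(Upair u v, l) \<in> edges (lattice_graph a D) \<longleftrightarrow> l = undefined \<and>
    (u \<in> range (lattice_vec a) \<and> v - u \<in> D \<or> v \<in> range (lattice_vec a) \<and> u - v \<in> D)"
proof
  assume "(Upair u v, l) \<in> edges (lattice_graph a D)"
  then show "l = undefined \<and>
      (u \<in> range (lattice_vec a) \<and> v - u \<in> D \<or> v \<in> range (lattice_vec a) \<and> u - v \<in> D)"
    by (auto simp: lattice_graph_def)
next
  have "(Upair x y, undefined) \<in> edges (lattice_graph a D)"
    if "x \<in> range (lattice_vec a)" "y - x \<in> D" for x y
    unfolding lattice_graph_def multigraph.select_convs
    by (rule CollectI, rule exI[of _ x], rule exI[of _ "y - x"]) (simp add: that)
  moreover have "Upair v u = Upair u v" by simp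
  ultimately show "(Upair u v, l) \<in> edges (lattice_graph a D)" if "l = undefined \<and>
      (u \<in> range (lattice_vec a) \<and> v - u \<in> D \<or> v \<in> range (lattice_vec a) \<and> u - v \<in> D)"
    using that by metis
qed

lemma lattice_vec_add_in_range_iff:
  "x + lattice_vec a m \<in> range (lattice_vec a) \<longleftrightarrow> x \<in> range (lattice_vec a)"
proof
  assume "x + lattice_vec a m \<in> range (lattice_vec a)"
  then obtain k where "x + lattice_vec a m = lattice_vec a k" by blast
  then have "x = lattice_vec a (k - m)" by (simp add: lattice_vec_diff eq_diff_eq)
  then show "x \<in> range (lattice_vec a)" by blast
next
  assume "x \<in> range (lattice_vec a)"
  then show "x + lattice_vec a m \<in> range (lattice_vec a)" by (auto simp flip: lattice_vec_add)
qed

lemma finite_int_vec_box: "finite {m :: int ^ 'n::finite. \<forall>i. \<bar>m $ i\<bar> \<le> N}"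
proof (rule finite_subset)
  show "{m :: int ^ 'n. \<forall>i. \<bar>m $ i\<bar> \<le> N} \<subseteq> vec_lambda ` (UNIV \<rightarrow>\<^sub>E {-N..N})"
  proof
    fix m :: "int ^ 'n" assume "m \<in> {m. \<forall>i. \<bar>m $ i\<bar> \<le> N}"
    then have "vec_nth m \<in> UNIV \<rightarrow>\<^sub>E {-N..N}" by (auto simp: abs_le_iff minus_le_iff)
    then show "m \<in> vec_lambda ` (UNIV \<rightarrow>\<^sub>E {-N..N})" by (rule rev_image_eqI) simp
  qed
  show "finite (vec_lambda ` (UNIV \<rightarrow>\<^sub>E {-N..N}) :: (int ^ 'n) set)"
    by (intro finite_imageI finite_PiE) auto
qed

context lattice_basis
begin

text \<open>Coordinates are bounded on bounded sets, and only finitely many integer vectors obey a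
  given bound on their entries.\<close>

lemma finite_lattice_vec_vimage:
  assumes "bounded S"
  shows "finite {m. lattice_vec a m \<in> S}"
proof -
  obtain K where K: "0 < K" "\<And>x. norm (coord x) \<le> norm x * K"
    using linear_conv_bounded_linear linear_coord bounded_linear.pos_bounded by blast
  obtain B where B: "\<And>x. x \<in> S \<Longrightarrow> norm x \<le> B" using assms by (auto simp: bounded_iff)
  have "\<bar>m $ i\<bar> \<le> \<lceil>B * K\<rceil>" if "lattice_vec a m \<in> S" for m i
  proof -
    have "of_int \<bar>m $ i\<bar> = \<bar>coord (lattice_vec a m) $ i\<bar>" by (simp add: coord_lattice_vec)
    also have "\<dots> \<le> norm (coord (lattice_vec a m))" by (rule component_le_norm_cart)
    also have "\<dots> \<le> norm (lattice_vec a m) * K" by (rule K)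
    also have "\<dots> \<le> B * K" using B[OF that] K(1) by simp
    finally show ?thesis by linarith
  qed
  then have "{m. lattice_vec a m \<in> S} \<subseteq> {m. \<forall>i. \<bar>m $ i\<bar> \<le> \<lceil>B * K\<rceil>}" by auto
  then show ?thesis by (rule finite_subset) (rule finite_int_vec_box)
qed

lemma periods_lattice_graph: "periods (lattice_graph a D) a" (is "periods ?\<Gamma> a")
proof -
  have "translate_graph (lattice_vec a m) ?\<Gamma> = ?\<Gamma>" for m
  proof -
    have *: "x - lattice_vec a m \<in> range (lattice_vec a) \<longleftrightarrow> x \<in> range (lattice_vec a)" for x
      using lattice_vec_add_in_range_iff[of "x - lattice_vec a m" a m] by simp
    show ?thesis
      unfolding translate_graph_eq_iff edges_lattice_graph * by (simp add: lattice_graph_def *)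
  qed
  from this[of "axis s 1" for s] have "translate_graph (a s) ?\<Gamma> = ?\<Gamma>" for s
    by (simp only: lattice_vec_axis)
  then show ?thesis
    by (simp add: periods_def inj_basis independent_basis span_basis)
qed

text \<open>Each period is an edge step; walks are concatenated for sums and reversed for negatives.
  The starting point varies because the second walk starts where the first ends.\<close>

lemma lattice_graph_reachable:
  assumes D: "range a \<subseteq> D" and x: "x \<in> range (lattice_vec a)"
  shows "(x, x + lattice_vec a m) \<in> (adjacency (lattice_graph a D))\<^sup>*"
  using x
proof (induction m arbitrary: x rule: int_vec_induct)
  case zero
  then show ?case by simp
next
  case (add m k)
  then show ?case
    using rtrancl_trans[OF add.IH(1)[of x] add.IH(2)[of "x + lattice_vec a m"]]
    by (simp add: lattice_vec_add_in_range_iff lattice_vec_add add.assoc)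
next
  case (uminus m)
  then have "x - lattice_vec a m \<in> range (lattice_vec a)"
    using lattice_vec_add_in_range_iff[of x a "- m"] by (simp add: lattice_vec_uminus)
  from uminus.IH[OF this] show ?case
    using symD[OF sym_adjacency_rtrancl] by (simp add: lattice_vec_uminus)
next
  case (axis i)
  then have "(Upair x (x + a i), undefined) \<in> edges (lattice_graph a D)"
    using D by (auto simp: edges_lattice_graph)
  then show ?case by (auto simp: lattice_vec_axis intro: edge_in_adjacency)
qed

text \<open>All vertices form one lattice orbit, so the fundamental graph has one vertex and only
  loops. Connectedness comes from the periods in \<open>D\<close>, finite degrees from the
  finiteness of \<open>D\<close>.\<close>

lemma loop_graph_lattice_graph:
  assumes D: "range a \<subseteq> D" "D \<subseteq> range (lattice_vec a)" "finite D"
  shows "loop_graph (lattice_graph a D :: (real ^ 'n, 'l) multigraph)" (is "loop_graph ?\<Gamma>")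
proof -
  have per: "periods ?\<Gamma> a" by (rule periods_lattice_graph)
  have vertices: "vertices ?\<Gamma> = range (lattice_vec a)" by (simp add: lattice_graph_def)
  have edge: "u \<in> range (lattice_vec a) \<and> v \<in> range (lattice_vec a) \<and> v - u \<in> range (lattice_vec a)"
    if "(Upair u v, l) \<in> edges ?\<Gamma>" for u v l
  proof -
    have "w \<in> range (lattice_vec a) \<and> w - x \<in> range (lattice_vec a) \<and> x - w \<in> range (lattice_vec a)"
      if "x \<in> range (lattice_vec a)" "w - x \<in> D" for x w
    proof -
      from that D(2) obtain m where m: "w - x = lattice_vec a m" by blast
      then have w: "w = x + lattice_vec a m" by (simp add: diff_eq_eq add.commute)
      then have "x - w = lattice_vec a (- m)" by (simp add: lattice_vec_uminus)
      moreover have "w \<in> range (lattice_vec a)" using that w by (simp add: lattice_vec_add_in_range_iff)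
      ultimately show ?thesis using m by simp
    qed
    then show ?thesis using that unfolding edges_lattice_graph by blast
  qed
  have "connected_multigraph ?\<Gamma>"
    unfolding connected_multigraph_iff
  proof (intro conjI ballI)
    show "wf_multigraph ?\<Gamma>" using edge by (intro wf_multigraphI) (auto simp: vertices)
    show "vertices ?\<Gamma> \<noteq> {}" by (simp add: vertices)
    fix u v assume u: "u \<in> vertices ?\<Gamma>" and "v \<in> vertices ?\<Gamma>"
    then obtain m k where "u = lattice_vec a m" "v = lattice_vec a k" by (auto simp: vertices)
    then have "v = u + lattice_vec a (k - m)" by (simp add: lattice_vec_diff)
    then show "(u, v) \<in> (adjacency ?\<Gamma>)\<^sup>*"
      using lattice_graph_reachable[OF D(1)] u by (simp add: vertices)
  qed
  moreover have "finite (vertices ?\<Gamma> \<inter> S)" if "bounded S" for S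
  proof -
    have "vertices ?\<Gamma> \<inter> S = lattice_vec a ` {m. lattice_vec a m \<in> S}" by (auto simp: vertices)
    then show ?thesis using finite_lattice_vec_vimage[OF that] by simp
  qed
  moreover have "finite (out_arcs (oriented_graph ?\<Gamma>) u)" for u
    unfolding finite_out_arcs_iff
  proof (rule finite_subset)
    show "{(w, l). (Upair u w, l) \<in> edges ?\<Gamma>} \<subseteq> ((\<lambda>d. u + d) ` D \<union> (\<lambda>d. u - d) ` D) \<times> {undefined}"
    proof (rule subsetI, unfold mem_Collect_eq split_paired_all case_prod_conv)
      fix w l assume "(Upair u w, l) \<in> edges ?\<Gamma>"
      moreover have "w = u + (w - u)" "w = u - (u - w)" by simp_all
      ultimately show "(w, l) \<in> ((\<lambda>d. u + d) ` D \<union> (\<lambda>d. u - d) ` D) \<times> {undefined}"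
        unfolding edges_lattice_graph by blast
    qed
  qed (use D(3) in simp)
  ultimately have "periodic_graph ?\<Gamma>" using per unfolding periodic_graph_def by blast
  moreover have "loop_fundamental ?\<Gamma> 0 a"
    using per edge by (auto simp: loop_fundamental_iff)
  ultimately show ?thesis unfolding loop_graph_def by blast
qed

text \<open>
  Three bridge indices \<open>m\<close>, \<open>k\<close> and \<open>m + k\<close> cannot all have cosine \<open>-1\<close>. The argument works for
  all choices of periods, since every \<open>d \<in> D\<close> lies in the lattice of any loop fundamental graph.
\<close>

lemma not_precise_lattice_graph:
  assumes D: "D \<subseteq> range (lattice_vec a)" "d \<in> D" "d' \<in> D" "d + d' \<in> D"
    and nz: "d \<noteq> 0" "d' \<noteq> 0" "d + d' \<noteq> 0"
  shows "\<not> precise (lattice_graph a D :: (real ^ 'n, 'l) multigraph)" (is "\<not> precise ?\<Gamma>")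
proof
  assume "precise ?\<Gamma>"
  then obtain p b \<theta> where pq: "precise_quasimomentum ?\<Gamma> p b \<theta>" by (auto simp: precise_def)
  then have lf: "loop_fundamental ?\<Gamma> p b" by (simp add: precise_quasimomentum_def)
  interpret b: lattice_basis b using lf by (auto simp: loop_fundamental_def intro: periods_lattice_basis)
  let ?v = "\<lambda>m :: int ^ 'n. (\<chi> i. of_int (m $ i)) :: real ^ 'n"
  \<comment> \<open>The edge from 0 to \<open>e\<close>, repeated along its own direction, shows
    that \<open>e\<close> lies in the lattice of \<open>b\<close>; its coordinates \<open>m\<close>
    there are the index of a bridge.\<close>
  have bridge: "\<exists>m. e = lattice_vec b m \<and> cos (?v m \<bullet> \<theta>) = -1" if "e \<in> D" "e \<noteq> 0" for e
  proof -
    have "(Upair (0 + of_nat k *\<^sub>R e) (0 + of_nat k *\<^sub>R e + e), undefined) \<in> edges ?\<Gamma>" for k :: nat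
    proof -
      obtain m where "e = lattice_vec a m" using D(1) \<open>e \<in> D\<close> by blast
      then have "of_nat k *\<^sub>R e = lattice_vec a (of_nat k * m)" by (simp add: lattice_vec_of_nat_mult)
      then have "of_nat k *\<^sub>R e \<in> range (lattice_vec a)" by simp
      then show ?thesis using \<open>e \<in> D\<close> by (simp add: edges_lattice_graph)
    qed
    from edge_vector_in_lattice[OF lf \<open>e \<noteq> 0\<close> this] obtain m where m: "e = lattice_vec b m" by blast
    have "0 \<in> range (lattice_vec a)" using rangeI[of "lattice_vec a" 0] by simp
    then have "(Upair 0 (0 + lattice_vec b m), undefined) \<in> edges ?\<Gamma>"
      using \<open>e \<in> D\<close> m by (simp add: edges_lattice_graph)
    moreover have "m \<noteq> 0" using m \<open>e \<noteq> 0\<close> by auto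
    ultimately show ?thesis using pq m unfolding precise_quasimomentum_iff by blast
  qed
  obtain m where m: "d = lattice_vec b m" "cos (?v m \<bullet> \<theta>) = -1" using bridge D nz by blast
  obtain k where k: "d' = lattice_vec b k" "cos (?v k \<bullet> \<theta>) = -1" using bridge D nz by blast
  obtain j where j: "d + d' = lattice_vec b j" "cos (?v j \<bullet> \<theta>) = -1" using bridge D nz by blast
  have "j = m + k" using j m k inj_eq[OF b.inj_lattice_vec] by (simp flip: lattice_vec_add)
  then have "?v j = ?v m + ?v k" by (simp add: vec_eq_iff)
  then have "?v j \<bullet> \<theta> = ?v m \<bullet> \<theta> + ?v k \<bullet> \<theta>" by (simp add: inner_add_left)
  \<comment> \<open>Where the cosine is \<open>-1\<close> the sine vanishes, so the addition theorem
    leaves \<open>(-1) * (-1)\<close>.\<close>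
  moreover have "sin (?v m \<bullet> \<theta>) = 0" using sin_cos_squared_add[of "?v m \<bullet> \<theta>"] m by simp
  ultimately have "cos (?v j \<bullet> \<theta>) = 1" using m k by (simp add: cos_add)
  then show False using j by simp
qed

end

lemma ex_loop_graph_not_precise:
  assumes "2 \<le> CARD('n::finite)"
  shows "\<exists>\<Gamma> :: (real ^ 'n, 'l) multigraph. loop_graph \<Gamma> \<and> \<not> precise \<Gamma>"
proof -
  define a :: "'n \<Rightarrow> real ^ 'n" where "a = (\<lambda>i. axis i 1)"
  have "range a = Basis" by (auto simp: a_def Basis_vec_def)
  then interpret lattice_basis a
    by unfold_locales (auto simp: a_def inj_def axis_eq_axis independent_Basis span_Basis)
  \<comment> \<open>Two different directions exist because the dimension is at least 2.\<close>
  obtain i j :: 'n where "i \<noteq> j"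
    using assms by (metis (full_types) card_2_iff' ex_card)
  \<comment> \<open>The periods alone would allow the quasimomentum with all entries
    \<open>pi\<close>; the diagonal \<open>a i + a j\<close> excludes it and all others.\<close>
  define D where "D = insert (a i + a j) (range a)"
  have a_in: "a k \<in> range (lattice_vec a)" for k by (metis lattice_vec_axis rangeI)
  moreover have "a i + a j \<in> range (lattice_vec a)"
    by (metis lattice_vec_axis lattice_vec_add rangeI)
  ultimately have D: "D \<subseteq> range (lattice_vec a)" by (auto simp: D_def)
  have nz: "a k \<noteq> 0" for k by (simp add: a_def axis_eq_0_iff)
  have "(a i + a j) $ i = 1" using \<open>i \<noteq> j\<close> by (simp add: a_def axis_def)
  then have "a i + a j \<noteq> 0" by (metis zero_index zero_neq_one)
  then have "\<not> precise (lattice_graph a D :: (real ^ 'n, 'l) multigraph)"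
    using D nz by (intro not_precise_lattice_graph[of D "a i" "a j"]) (auto simp: D_def)
  moreover have "loop_graph (lattice_graph a D :: (real ^ 'n, 'l) multigraph)"
    using D by (intro loop_graph_lattice_graph) (auto simp: D_def)
  ultimately show ?thesis by blast
qed


section \<open>Attaching copies of a finite graph\<close>

lemma attach_copies_simps:
  "vertices (attach_copies \<Gamma> a v \<Gamma>' v') =
    vertices \<Gamma> \<union> (\<Union>m. vertices (translate_graph (v + lattice_vec a m - v') \<Gamma>'))"
  "edges (attach_copies \<Gamma> a v \<Gamma>' v') = map_prod id Inl ` edges \<Gamma> \<union>
    map_prod id Inr ` (\<Union>m. edges (translate_graph (v + lattice_vec a m - v') \<Gamma>'))"
  by (simp_all add: attach_copies_def Let_def)

lemma vertices_attach_copies: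
  "x \<in> vertices (attach_copies \<Gamma> a v \<Gamma>' v') \<longleftrightarrow>
    x \<in> vertices \<Gamma> \<or> (\<exists>m. x - (v + lattice_vec a m - v') \<in> vertices \<Gamma>')"
  by (simp add: attach_copies_simps vertices_translate_graph)

lemma Inl_edges_attach_copies:
  "(e, Inl l) \<in> edges (attach_copies \<Gamma> a v \<Gamma>' v') \<longleftrightarrow> (e, l) \<in> edges \<Gamma>"
  by (force simp: attach_copies_simps)

lemma Inr_edges_attach_copies:
  "(Upair x y, Inr k) \<in> edges (attach_copies \<Gamma> a v \<Gamma>' v') \<longleftrightarrow>
    (\<exists>m. (Upair (x - (v + lattice_vec a m - v')) (y - (v + lattice_vec a m - v')), k) \<in> edges \<Gamma>')"
proof -
  have "(Upair x y, Inr k) \<in> edges (attach_copies \<Gamma> a v \<Gamma>' v') \<longleftrightarrow>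
      (\<exists>m. (Upair x y, k) \<in> edges (translate_graph (v + lattice_vec a m - v') \<Gamma>'))"
    by (force simp: attach_copies_simps)
  then show ?thesis by (simp add: edges_translate_graph)
qed

lemma edges_attach_copies_cases:
  assumes "(Upair x y, l) \<in> edges (attach_copies \<Gamma> a v \<Gamma>' v')"
  obtains (old) l' where "l = Inl l'" "(Upair x y, l') \<in> edges \<Gamma>"
  | (copy) m k where "l = Inr k"
      "(Upair (x - (v + lattice_vec a m - v')) (y - (v + lattice_vec a m - v')), k) \<in> edges \<Gamma>'"
  using assms by (cases l) (auto simp: Inl_edges_attach_copies Inr_edges_attach_copies)

text \<open>Translation by \<open>lattice_vec a k\<close> permutes the copies, sending the one with
  number \<open>m\<close> to the one with number \<open>m + k\<close>.\<close>

lemma periods_attach_copies: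
  assumes per: "periods \<Gamma> a"
  shows "periods (attach_copies \<Gamma> a v \<Gamma>' v') a" (is "periods ?\<Gamma>s a")
proof -
  have shift: "(\<exists>m. P (lattice_vec a m + lattice_vec a k)) \<longleftrightarrow> (\<exists>m. P (lattice_vec a m))" for P k
    by (metis diff_add_cancel lattice_vec_add)
  have "translate_graph (lattice_vec a k) ?\<Gamma>s = ?\<Gamma>s" for k
  proof -
    have eq: "x - lattice_vec a k - (v + lattice_vec a m - v') =
        x - (v + (lattice_vec a m + lattice_vec a k) - v')" for x m by simp
    have old: "x - lattice_vec a k \<in> vertices \<Gamma> \<longleftrightarrow> x \<in> vertices \<Gamma>"
      "(Upair (x - lattice_vec a k) (y - lattice_vec a k), l) \<in> edges \<Gamma> \<longleftrightarrow> (Upair x y, l) \<in> edges \<Gamma>" for x y l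
      using translate_graph_lattice_vec[OF per, of k] unfolding translate_graph_eq_iff by blast+
    have "(Upair (x - lattice_vec a k) (y - lattice_vec a k), l) \<in> edges ?\<Gamma>s \<longleftrightarrow>
        (Upair x y, l) \<in> edges ?\<Gamma>s" for x y l
    proof (cases l)
      case (Inl l')
      then show ?thesis by (simp only: Inl_edges_attach_copies old)
    next
      case (Inr l')
      show ?thesis
        unfolding Inr Inr_edges_attach_copies eq
        by (rule shift[of "\<lambda>w. (Upair (x - (v + w - v')) (y - (v + w - v')), l') \<in> edges \<Gamma>'"])
    qed
    moreover have "x - lattice_vec a k \<in> vertices ?\<Gamma>s \<longleftrightarrow> x \<in> vertices ?\<Gamma>s" for x
      unfolding vertices_attach_copies eq old
      using shift[of "\<lambda>w. x - (v + w - v') \<in> vertices \<Gamma>'"] by simp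
    ultimately show ?thesis unfolding translate_graph_eq_iff by blast
  qed
  from this[of "axis s 1" for s] have "translate_graph (a s) ?\<Gamma>s = ?\<Gamma>s" for s
    by (simp only: lattice_vec_axis)
  then show ?thesis using per by (simp add: periods_def)
qed

text \<open>From \<open>v\<close> a walk in \<open>\<Gamma>\<close> leads to the attachment point
  \<open>v + lattice_vec a m\<close> of any copy, and a walk in the copy leads on to its vertices.
  Reversal of walks then joins any two vertices through \<open>v\<close>.\<close>

lemma connected_attach_copies:
  assumes conn: "connected_multigraph \<Gamma>" and per: "periods \<Gamma> a" and v: "v \<in> vertices \<Gamma>"
    and conn': "connected_multigraph \<Gamma>'" and v': "v' \<in> vertices \<Gamma>'"
  shows "connected_multigraph (attach_copies \<Gamma> a v \<Gamma>' v')" (is "connected_multigraph ?\<Gamma>s")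
proof -
  let ?c = "\<lambda>m. v + lattice_vec a m - v'"
  have wf: "wf_multigraph \<Gamma>" "wf_multigraph \<Gamma>'"
    using conn conn' by (simp_all add: connected_multigraph_iff)
  have "x \<in> vertices ?\<Gamma>s \<and> y \<in> vertices ?\<Gamma>s" if "(Upair x y, l) \<in> edges ?\<Gamma>s" for x y l
    using that
  proof (cases rule: edges_attach_copies_cases)
    case old
    then show ?thesis using wf_multigraphD[OF wf(1)] unfolding vertices_attach_copies by blast
  next
    case copy
    then show ?thesis using wf_multigraphD[OF wf(2)] unfolding vertices_attach_copies by blast
  qed
  then have wfs: "wf_multigraph ?\<Gamma>s" by (rule wf_multigraphI)
  have old: "(x, y) \<in> (adjacency ?\<Gamma>s)\<^sup>*" if "x \<in> vertices \<Gamma>" "y \<in> vertices \<Gamma>" for x y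
  proof -
    have "adjacency \<Gamma> \<subseteq> adjacency ?\<Gamma>s"
      by (auto simp: adjacency_def intro: Inl_edges_attach_copies[THEN iffD2])
    then have "(adjacency \<Gamma>)\<^sup>* \<subseteq> (adjacency ?\<Gamma>s)\<^sup>*" by (rule rtrancl_mono)
    then show ?thesis using conn that by (auto simp: connected_multigraph_iff)
  qed
  have copy_edge: "(x + ?c m, y + ?c m) \<in> adjacency ?\<Gamma>s" if "(x, y) \<in> adjacency \<Gamma>'" for x y m
  proof -
    from that obtain l where "(Upair x y, l) \<in> edges \<Gamma>'" by (auto simp: adjacency_def)
    then have "(Upair (x + ?c m - ?c m) (y + ?c m - ?c m), l) \<in> edges \<Gamma>'"
      by (simp only: add_diff_cancel_right')
    then have "(Upair (x + ?c m) (y + ?c m), Inr l) \<in> edges ?\<Gamma>s"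
      unfolding Inr_edges_attach_copies by (rule exI)
    then show ?thesis by (rule edge_in_adjacency)
  qed
  have copy: "(x + ?c m, y + ?c m) \<in> (adjacency ?\<Gamma>s)\<^sup>*" if "(x, y) \<in> (adjacency \<Gamma>')\<^sup>*" for x y m
    using that
  proof (induction rule: rtrancl_induct)
    case (step y z)
    then show ?case using copy_edge by (blast intro: rtrancl_into_rtrancl)
  qed simp
  have reach: "(v, x) \<in> (adjacency ?\<Gamma>s)\<^sup>*" if "x \<in> vertices ?\<Gamma>s" for x
    using that unfolding vertices_attach_copies
  proof
    assume "\<exists>m. x - ?c m \<in> vertices \<Gamma>'"
    then obtain m where "x - ?c m \<in> vertices \<Gamma>'" by blast
    then have "(v', x - ?c m) \<in> (adjacency \<Gamma>')\<^sup>*"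
      using conn' v' by (auto simp: connected_multigraph_iff)
    from copy[OF this, of m] have "(v + lattice_vec a m, x) \<in> (adjacency ?\<Gamma>s)\<^sup>*" by simp
    moreover have "(v, v + lattice_vec a m) \<in> (adjacency ?\<Gamma>s)\<^sup>*"
      using old v vertices_add_lattice_vec[OF per] by blast
    ultimately show ?thesis by (rule rtrancl_trans[rotated])
  qed (use old v in blast)
  show ?thesis
    unfolding connected_multigraph_iff
  proof (intro conjI ballI wfs)
    have "v \<in> vertices ?\<Gamma>s" using v by (simp add: vertices_attach_copies)
    then show "vertices ?\<Gamma>s \<noteq> {}" by blast
    fix x y assume "x \<in> vertices ?\<Gamma>s" "y \<in> vertices ?\<Gamma>s"
    then show "(x, y) \<in> (adjacency ?\<Gamma>s)\<^sup>*"
      by (rule rtrancl_trans[OF symD[OF sym_adjacency_rtrancl] reach, OF reach])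
  qed
qed

text \<open>Local finiteness holds because the lattice is discrete and \<open>\<Gamma>'\<close>
  finite: only finitely many copies meet a bounded set, and each contributes finitely many vertices
  and edges.\<close>

lemma periodic_attach_copies:
  assumes \<Gamma>: "periodic_graph \<Gamma>" and per: "periods \<Gamma> a" and v: "v \<in> vertices \<Gamma>"
    and conn': "connected_multigraph \<Gamma>'" and fin': "finite_multigraph \<Gamma>'" and v': "v' \<in> vertices \<Gamma>'"
  shows "periodic_graph (attach_copies \<Gamma> a v \<Gamma>' v')" (is "periodic_graph ?\<Gamma>s")
proof -
  interpret lattice_basis a using per by (rule periods_lattice_basis)
  let ?c = "\<lambda>m. v + lattice_vec a m - v'"
  have conn: "connected_multigraph \<Gamma>" using \<Gamma> by (simp add: periodic_graph_def)
  have finV: "finite (vertices \<Gamma>')" and finE: "finite (edges \<Gamma>')"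
    using fin' by (simp_all add: finite_multigraph_def)
  have meet: "finite {m. \<exists>x\<in>S. x - ?c m \<in> vertices \<Gamma>'}" if "bounded S" for S
  proof -
    \<comment> \<open>If \<open>x\<close> in \<open>S\<close> is the image of the vertex
      \<open>y\<close> in copy \<open>m\<close>, then
      \<open>lattice_vec a m = x - y + (v' - v)\<close>; \<open>T\<close> collects all these
      candidates.\<close>
    define T where "T = (\<Union>x\<in>S. \<Union>y\<in>vertices \<Gamma>'. {x - y + (v' - v)})"
    have "T = (\<lambda>x. (v' - v) + x) ` (\<Union>x\<in>S. \<Union>y\<in>vertices \<Gamma>'. {x - y})"
      by (auto simp: T_def image_UN)
    moreover have "bounded (\<Union>x\<in>S. \<Union>y\<in>vertices \<Gamma>'. {x - y})"
      by (rule bounded_differences[OF that finite_imp_bounded[OF finV]])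
    ultimately have "bounded T" by (simp only: bounded_translation)
    moreover have "lattice_vec a m \<in> T" if "x \<in> S" "x - ?c m \<in> vertices \<Gamma>'" for x m
    proof -
      have "lattice_vec a m = x - (x - ?c m) + (v' - v)" by simp
      then show ?thesis using that unfolding T_def by blast
    qed
    ultimately show ?thesis
      by (intro finite_subset[OF _ finite_lattice_vec_vimage[of T]]) auto
  qed
  have finite_vertices: "finite (vertices ?\<Gamma>s \<inter> S)" if S: "bounded S" for S
  proof -
    have "vertices ?\<Gamma>s \<inter> S \<subseteq> (vertices \<Gamma> \<inter> S) \<union>
        (\<lambda>(m, y). y + ?c m) ` ({m. \<exists>x\<in>S. x - ?c m \<in> vertices \<Gamma>'} \<times> vertices \<Gamma>')"
    proof
      fix x assume x: "x \<in> vertices ?\<Gamma>s \<inter> S"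
      then consider "x \<in> vertices \<Gamma>" | m where "x - ?c m \<in> vertices \<Gamma>'"
        by (auto simp: vertices_attach_copies)
      then show "x \<in> (vertices \<Gamma> \<inter> S) \<union>
        (\<lambda>(m, y). y + ?c m) ` ({m. \<exists>x\<in>S. x - ?c m \<in> vertices \<Gamma>'} \<times> vertices \<Gamma>')"
      proof cases
        case 2
        then show ?thesis
          using x by (intro UnI2 image_eqI[of _ _ "(m, x - ?c m)"]) auto
      qed (use x in blast)
    qed
    moreover have "finite (vertices \<Gamma> \<inter> S)" using \<Gamma> S by (simp add: periodic_graph_def)
    ultimately show ?thesis using meet[OF S] finV by (auto intro: finite_subset)
  qed
  have finite_out_arcs: "finite (out_arcs (oriented_graph ?\<Gamma>s) x)" for x
    unfolding finite_out_arcs_iff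
  proof (rule finite_subset)
    \<comment> \<open>The copies containing \<open>x\<close>, finitely many by \<open>meet\<close>
      for a one-point set.\<close>
    let ?M = "{m. \<exists>x'\<in>{x}. x' - ?c m \<in> vertices \<Gamma>'}"
    let ?old = "{(y, l). (Upair x y, l) \<in> edges \<Gamma>}"
    let ?copy = "\<lambda>m. {(y, k). (Upair (x - ?c m) (y - ?c m), k) \<in> edges \<Gamma>'}"
    show "{(y, l). (Upair x y, l) \<in> edges ?\<Gamma>s} \<subseteq>
        map_prod id Inl ` ?old \<union> map_prod id Inr ` (\<Union>m\<in>?M. ?copy m)"
    proof (rule subsetI, unfold mem_Collect_eq split_paired_all case_prod_conv)
      fix y l assume "(Upair x y, l) \<in> edges ?\<Gamma>s"
      then show "(y, l) \<in> map_prod id Inl ` ?old \<union> map_prod id Inr ` (\<Union>m\<in>?M. ?copy m)"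
      proof (cases rule: edges_attach_copies_cases)
        case (old l')
        then show ?thesis by (intro UnI1 image_eqI[of _ _ "(y, l')"]) auto
      next
        case (copy m k)
        then have "m \<in> ?M"
          using conn' wf_multigraphD(1)[OF _ copy(2)] by (simp add: connected_multigraph_iff)
        then show ?thesis using copy by (intro UnI2 image_eqI[of _ _ "(y, k)"]) auto
      qed
    qed
    have "finite ?old"
    proof (cases "x \<in> vertices \<Gamma>")
      case True
      then show ?thesis using \<Gamma> by (simp add: periodic_graph_def finite_out_arcs_iff)
    next
      case False
      \<comment> \<open>Finite degree is given at vertices of \<open>\<Gamma>\<close> only; at any
        other point there are no edges of \<open>\<Gamma>\<close>.\<close>
      have "wf_multigraph \<Gamma>" using conn by (simp add: connected_multigraph_iff)
      from wf_multigraphD(1)[OF this, of x] False have "?old = {}" by blast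
      then show ?thesis by simp
    qed
    moreover have "finite (?copy m)" for m
    proof (rule finite_imageD)
      \<comment> \<open>With one end fixed at \<open>x\<close>, the edge of \<open>\<Gamma>'\<close>
        determines the other end, so the labelled neighbours inject into a finite edge set.\<close>
      let ?f = "\<lambda>(y, k). (Upair (x - ?c m) (y - ?c m), k)"
      show "finite (?f ` ?copy m)" by (rule finite_subset[OF _ finE]) auto
      show "inj_on ?f (?copy m)" by (rule inj_onI) auto
    qed
    moreover have "finite ?M" by (rule meet) simp
    ultimately show "finite (map_prod id Inl ` ?old \<union> map_prod id Inr ` (\<Union>m\<in>?M. ?copy m))"
      by (intro finite_UnI finite_imageI finite_UN_I)
  qed
  show ?thesis
    unfolding periodic_graph_def
    by (intro conjI allI impI ballI exI[of _ a] connected_attach_copies[OF conn per v conn' v']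
      finite_vertices finite_out_arcs periods_attach_copies[OF per])
qed

section \<open>Bridges and quasimomenta of the decorated graph\<close>

text \<open>
  With the origin \<open>q\<close>, each attached copy lies in one cell. Consequently its edges join no two
  distinct points of one orbit, and they are bridges for no choice of the origin.
\<close>

lemma int_part_attached_edge:
  assumes per: "periods \<Gamma> a" and v: "v \<in> vertices \<Gamma>"
    and near: "\<And>x y. x \<in> vertices \<Gamma> \<Longrightarrow> dist x y < \<delta> \<Longrightarrow> int_part q a y = int_part p a x"
    and wf': "wf_multigraph \<Gamma>'" and fin': "finite_multigraph \<Gamma>'" and v': "v' \<in> vertices \<Gamma>'"
    and diam: "diameter (vertices \<Gamma>') < \<delta>"
    and e: "(Upair (x - (v + lattice_vec a m - v')) (y - (v + lattice_vec a m - v')), k) \<in> edges \<Gamma>'"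
  shows "int_part q a x = int_part q a y"
proof -
  \<comment> \<open>Every vertex of the copy lies within the diameter of its attachment point, which
    is a vertex of \<open>\<Gamma>\<close>.\<close>
  have "int_part q a z = int_part p a (v + lattice_vec a m)"
    if "z - (v + lattice_vec a m - v') \<in> vertices \<Gamma>'" for z
  proof (rule near)
    show "v + lattice_vec a m \<in> vertices \<Gamma>" using v vertices_add_lattice_vec[OF per] by blast
    have "dist v' (z - (v + lattice_vec a m - v')) \<le> diameter (vertices \<Gamma>')"
      using fin' v' that
      by (intro diameter_bounded_bound) (auto simp: finite_multigraph_def finite_imp_bounded)
    moreover have "dist (v + lattice_vec a m) z = dist v' (z - (v + lattice_vec a m - v'))"
      by (simp add: dist_norm algebra_simps)
    ultimately show "dist (v + lattice_vec a m) z < \<delta>" using diam by simp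
  qed
  then show ?thesis using wf_multigraphD[OF wf' e] by simp
qed

text \<open>\<open>\<delta>\<close> comes from \<open>generic_origin\<close> and is fixed before
  \<open>\<Gamma>'\<close>. The same \<open>\<theta>\<close> works since the copies add no bridges.
  The second clause admits any \<open>q\<close> giving a loop fundamental graph, as the cosine
  condition in \<open>precise_quasimomentum_iff\<close> does not involve the origin.\<close>

lemma attach_copies_loop_precise:
  assumes \<Gamma>: "periodic_graph \<Gamma>" and lf: "loop_fundamental \<Gamma> p a" and v: "v \<in> vertices \<Gamma>"
  obtains \<delta> where "0 < \<delta>" and "\<And>(\<Gamma>' :: (real ^ 'n::finite, 'k) multigraph) v'.
    v' \<in> vertices \<Gamma>' \<Longrightarrow> connected_multigraph \<Gamma>' \<Longrightarrow> finite_multigraph \<Gamma>' \<Longrightarrow>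
    diameter (vertices \<Gamma>') < \<delta> \<Longrightarrow>
    (\<exists>q. loop_fundamental (attach_copies \<Gamma> a v \<Gamma>' v') q a) \<and>
    (\<forall>\<theta> q. precise_quasimomentum \<Gamma> p a \<theta> \<and> loop_fundamental (attach_copies \<Gamma> a v \<Gamma>' v') q a \<longrightarrow>
      precise_quasimomentum (attach_copies \<Gamma> a v \<Gamma>' v') q a \<theta>)"
proof -
  have per: "periods \<Gamma> a" using lf by (simp add: loop_fundamental_def)
  then interpret lattice_basis a by (rule periods_lattice_basis)
  have "finite (vertices \<Gamma> \<inter> cell p a)" using \<Gamma> bounded_cell by (simp add: periodic_graph_def)
  then obtain q \<delta> where \<delta>: "0 < \<delta>" and
    near: "\<And>x y. x \<in> vertices \<Gamma> \<Longrightarrow> dist x y < \<delta> \<Longrightarrow> int_part q a y = int_part p a x"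
    using generic_origin[of "vertices \<Gamma>" p] vertices_add_lattice_vec[OF per] by metis
  show thesis
  proof (rule that[OF \<delta>])
    fix \<Gamma>' :: "(real ^ 'n, 'k) multigraph" and v'
    assume v': "v' \<in> vertices \<Gamma>'" and conn': "connected_multigraph \<Gamma>'"
      and fin': "finite_multigraph \<Gamma>'" and diam: "diameter (vertices \<Gamma>') < \<delta>"
    let ?\<Gamma>s = "attach_copies \<Gamma> a v \<Gamma>' v'"
    have wf': "wf_multigraph \<Gamma>'" using conn' by (simp add: connected_multigraph_iff)
    have wf: "wf_multigraph \<Gamma>" using \<Gamma> by (simp add: periodic_graph_def connected_multigraph_iff)
    have attached: "int_part q a x = int_part q a y"
      if "(Upair (x - (v + lattice_vec a m - v')) (y - (v + lattice_vec a m - v')), k) \<in> edges \<Gamma>'"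
      for x y m k
      using int_part_attached_edge[OF per v _ wf' fin' v' diam that] near by blast
    have "y - x \<in> range (lattice_vec a)"
      if "(Upair x y, l) \<in> edges ?\<Gamma>s" "int_part q a x \<noteq> int_part q a y" for x y l
      using that(1)
    proof (cases rule: edges_attach_copies_cases)
      case (old l')
      \<comment> \<open>On old vertices the origins \<open>p\<close> and \<open>q\<close> give the
        same integer parts, so the old edges that are bridges stay the same.\<close>
      have "int_part q a z = int_part p a z" if "z \<in> vertices \<Gamma>" for z
        using near[OF that, of z] \<delta> by simp
      then have "int_part p a x \<noteq> int_part p a y" using that(2) wf_multigraphD[OF wf old(2)] by simp
      then show ?thesis using lf old(2) unfolding loop_fundamental_iff by blast
    next
      case (copy m k)
      then show ?thesis using attached that(2) by blast
    qed
    then have "loop_fundamental ?\<Gamma>s q a"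
      unfolding loop_fundamental_iff using periods_attach_copies[OF per] by blast
    moreover have "precise_quasimomentum ?\<Gamma>s q' a \<theta>"
      if pq: "precise_quasimomentum \<Gamma> p a \<theta>" and lfs: "loop_fundamental ?\<Gamma>s q' a" for \<theta> q'
      unfolding precise_quasimomentum_iff
    proof (intro conjI allI impI lfs)
      fix u l m assume e: "(Upair u (u + lattice_vec a m), l) \<in> edges ?\<Gamma>s" and m: "m \<noteq> 0"
      from e show "cos ((\<chi> i. of_int (m $ i)) \<bullet> \<theta>) = -1"
      proof (cases rule: edges_attach_copies_cases)
        case (old l')
        then show ?thesis using pq m unfolding precise_quasimomentum_iff by blast
      next
        case (copy k l')
        \<comment> \<open>The origin \<open>q\<close> may be used although the claim concerns
          \<open>q'\<close>: equal integer parts contradict a displacement by a nonzero lattice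
          vector.\<close>
        have "int_part q a u = int_part q a (u + lattice_vec a m)" by (rule attached[OF copy(2)])
        then show ?thesis using m by (simp add: int_part_translate)
      qed
    qed
    ultimately show "(\<exists>q. loop_fundamental ?\<Gamma>s q a) \<and>
      (\<forall>\<theta> q. precise_quasimomentum \<Gamma> p a \<theta> \<and> loop_fundamental ?\<Gamma>s q a \<longrightarrow>
        precise_quasimomentum ?\<Gamma>s q a \<theta>)" by blast
  qed
qed

text \<open>\<open>p\<close> and \<open>a\<close> range over all loop fundamental graphs of
  \<open>\<Gamma>\<close>, since coordinates may be taken from any of them. In the last clause
  \<open>q\<close> is arbitrary, so \<open>\<theta>\<close> serves every loop fundamental graph of
  \<open>\<Gamma>s\<close> with the periods \<open>a\<close>.\<close>

theorem proposition2p3: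
  assumes "2 \<le> CARD('n::finite)"
  shows "(\<exists>\<Gamma> :: (real ^ 'n, 'l) multigraph. loop_graph \<Gamma> \<and> \<not> precise \<Gamma>) \<and>
    (\<forall>(\<Gamma> :: (real ^ 'n, 'l) multigraph) p a. \<forall>v\<in>vertices \<Gamma>.
      loop_graph \<Gamma> \<and> loop_fundamental \<Gamma> p a \<longrightarrow>
      (\<exists>\<delta>>0. \<forall>\<Gamma>' :: (real ^ 'n, 'k) multigraph. \<forall>v'\<in>vertices \<Gamma>'.
        connected_multigraph \<Gamma>' \<and> finite_multigraph \<Gamma>' \<and> diameter (vertices \<Gamma>') < \<delta> \<longrightarrow>
        (let \<Gamma>s = attach_copies \<Gamma> a v \<Gamma>' v' in
          loop_graph \<Gamma>s \<and>
          (\<exists>q. loop_fundamental \<Gamma>s q a) \<and>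
          (precise \<Gamma> \<longrightarrow> precise \<Gamma>s) \<and>
          (\<forall>\<theta> q. precise_quasimomentum \<Gamma> p a \<theta> \<and> loop_fundamental \<Gamma>s q a \<longrightarrow>
            precise_quasimomentum \<Gamma>s q a \<theta>))))"
proof (intro conjI allI ballI impI)
  show "\<exists>\<Gamma> :: (real ^ 'n, 'l) multigraph. loop_graph \<Gamma> \<and> \<not> precise \<Gamma>"
    using assms by (rule ex_loop_graph_not_precise)
next
  fix \<Gamma> :: "(real ^ 'n, 'l) multigraph" and p a v
  assume v: "v \<in> vertices \<Gamma>" and "loop_graph \<Gamma> \<and> loop_fundamental \<Gamma> p a"
  then have \<Gamma>: "periodic_graph \<Gamma>" and lf: "loop_fundamental \<Gamma> p a" by (auto simp: loop_graph_def)
  then have conn: "connected_multigraph \<Gamma>" and per: "periods \<Gamma> a"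
    by (auto simp: periodic_graph_def loop_fundamental_def)
  obtain \<delta> where \<delta>: "0 < \<delta>" and attach: "\<And>(\<Gamma>' :: (real ^ 'n, 'k) multigraph) v'.
    v' \<in> vertices \<Gamma>' \<Longrightarrow> connected_multigraph \<Gamma>' \<Longrightarrow> finite_multigraph \<Gamma>' \<Longrightarrow>
    diameter (vertices \<Gamma>') < \<delta> \<Longrightarrow>
    (\<exists>q. loop_fundamental (attach_copies \<Gamma> a v \<Gamma>' v') q a) \<and>
    (\<forall>\<theta> q. precise_quasimomentum \<Gamma> p a \<theta> \<and> loop_fundamental (attach_copies \<Gamma> a v \<Gamma>' v') q a \<longrightarrow>
      precise_quasimomentum (attach_copies \<Gamma> a v \<Gamma>' v') q a \<theta>)"
    using attach_copies_loop_precise[OF \<Gamma> lf v] by blast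
  show "\<exists>\<delta>>0. \<forall>\<Gamma>' :: (real ^ 'n, 'k) multigraph. \<forall>v'\<in>vertices \<Gamma>'.
        connected_multigraph \<Gamma>' \<and> finite_multigraph \<Gamma>' \<and> diameter (vertices \<Gamma>') < \<delta> \<longrightarrow>
        (let \<Gamma>s = attach_copies \<Gamma> a v \<Gamma>' v' in
          loop_graph \<Gamma>s \<and>
          (\<exists>q. loop_fundamental \<Gamma>s q a) \<and>
          (precise \<Gamma> \<longrightarrow> precise \<Gamma>s) \<and>
          (\<forall>\<theta> q. precise_quasimomentum \<Gamma> p a \<theta> \<and> loop_fundamental \<Gamma>s q a \<longrightarrow>
            precise_quasimomentum \<Gamma>s q a \<theta>))"
  proof (intro exI[of _ \<delta>] conjI \<delta> allI ballI impI)
    fix \<Gamma>' :: "(real ^ 'n, 'k) multigraph" and v'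
    assume v': "v' \<in> vertices \<Gamma>'" and *: "connected_multigraph \<Gamma>' \<and> finite_multigraph \<Gamma>' \<and>
      diameter (vertices \<Gamma>') < \<delta>"
    define \<Gamma>s where "\<Gamma>s = attach_copies \<Gamma> a v \<Gamma>' v'"
    have lfs: "\<exists>q. loop_fundamental \<Gamma>s q a"
      and pqs: "\<forall>\<theta> q. precise_quasimomentum \<Gamma> p a \<theta> \<and> loop_fundamental \<Gamma>s q a \<longrightarrow>
        precise_quasimomentum \<Gamma>s q a \<theta>"
      using attach[OF v'] * unfolding \<Gamma>s_def by blast+
    have loop: "loop_graph \<Gamma>s"
      using periodic_attach_copies[OF \<Gamma> per v _ _ v'] * lfs unfolding loop_graph_def \<Gamma>s_def by blast
    have "precise \<Gamma>s" if "precise \<Gamma>"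
    proof -
      \<comment> \<open>Precision of \<open>\<Gamma>\<close> may be witnessed by periods other than
        \<open>a\<close>, so the quasimomentum is first carried over to \<open>a\<close>.\<close>
      from that obtain p' a' \<theta>' where "precise_quasimomentum \<Gamma> p' a' \<theta>'" by (auto simp: precise_def)
      from precise_quasimomentum_change_periods[OF conn lf this]
      obtain \<theta> where "precise_quasimomentum \<Gamma> p a \<theta>" .
      then show ?thesis using loop lfs pqs unfolding precise_def by blast
    qed
    then show "let \<Gamma>s = attach_copies \<Gamma> a v \<Gamma>' v' in
          loop_graph \<Gamma>s \<and>
          (\<exists>q. loop_fundamental \<Gamma>s q a) \<and>
          (precise \<Gamma> \<longrightarrow> precise \<Gamma>s) \<and>
          (\<forall>\<theta> q. precise_quasimomentum \<Gamma> p a \<theta> \<and> loop_fundamental \<Gamma>s q a \<longrightarrow>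
            precise_quasimomentum \<Gamma>s q a \<theta>)"
      using loop lfs pqs unfolding Let_def \<Gamma>s_def by blast
  qed
qed

end
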